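(* In the setting of the context, let $\xi\sim\mathcal N(0,Q)$ and, for $k\in\{1,\dots,q\}$, let $\xi^{(k)}:=\mathbb E[\xi\mid\sigma(\Phi^{(k)})]$. Then: (1) $\sigma(\Phi^{(1)}),\dots,\sigma(\Phi^{(q)})$ forms a filtration, i.e. $\sigma(\Phi^{(k)})\subset\sigma(\Phi^{(k+1)})$; (2) $\xi^{(k)}$ is a martingale with respect to the filtration $(\sigma(\Phi^{(k)}))_{k\ge1}$, i.e. $\xi^{(k)}=\mathbb E[\xi^{(k+1)}\mid\sigma(\Phi^{(k)})]$; (3) $\xi^{(1)}$ and the increments $(\xi^{(k+1)}-\xi^{(k)})_{k\ge1}$ are independent Gaussian fields. Furthermore, $$\xi^{(k)}=\sum_{i\in\mathcal I^{(k)}}\psi^{(k)}_i\,[\phi^{(k)}_i,\xi].$$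
   Context: $(\mathcal B,\|\cdot\|)$ is a reflexive separable Banach space with dual $\mathcal B^*$ and pairing $[\cdot,\cdot]$, with $\|u\|^2=[Q^{-1}u,u]$ for a symmetric positive bijective linear operator $Q:\mathcal B^*\to\mathcal B$. Let $q\in\mathbb N^*\cup\{\infty\}$ and let $\mathcal I^{(q)}$ be an index tree of depth $q$, i.e. a finite set of $q$-tuples; $i^{(k)}:=(i_1,\dots,i_k)$ and $\mathcal I^{(k)}:=\{i^{(k)}:i\in\mathcal I^{(q)}\}$. For $k\in\{1,\dots,q-1\}$, $\pi^{(k,k+1)}$ is an $\mathcal I^{(k)}\times\mathcal I^{(k+1)}$ matrix of rank $|\mathcal I^{(k)}|$. $(\phi^{(q)}_i)_{i\in\mathcal I^{(q)}}$ are linearly independent in $\mathcal B^*$ and $\phi^{(k)}_i=\sum_{j\in\mathcal I^{(k+1)}}\pi^{(k,k+1)}_{i,j}\phi^{(k+1)}_j$ for $k\in\{1,\dots,q-1\}$; $\Phi^{(k)}:=\operatorname{span}\{\phi^{(k)}_i:i\in\mathcal I^{(k)}\}$. When $q=\infty$, the ranges of $k$ are read as all finite levels, $\mathcal I^{(\infty)}$ is a set of infinite sequences with every $\mathcal I^{(k)}$ finite, and $(\phi^{(k)}_i)_{i\in\mathcal I^{(k)}}$, $k\ge1$, are families in $\mathcal B^*$, linearly independent for each $k$, satisfying the nesting relation for every $k\ge1$. Gamblets: $\psi^{(k)}_i$ is the minimizer of $\|\psi\|$ over $\psi\in\mathcal B$ with $[\phi^{(k)}_j,\psi]=\delta_{i,j}$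 for $j\in\mathcal I^{(k)}$. Gaussian field: a Gaussian field $\xi\sim\mathcal N(0,Q)$ with covariance operator $Q$ is a linear isometry $\varphi\mapsto[\varphi,\xi]$ from $\mathcal B^*$, with inner product $[\varphi_1,Q\varphi_2]$, into an $L^2$ space of a probability space, whose image is a Gaussian space (consists of centered Gaussian random variables). The same term is used for conditional expectations and increments, whose covariance operator $T:\mathcal B^*\to\mathcal B$ is symmetric and nonnegative but need not be bijective: the map is then isometric for the semi-inner product $[\varphi_1,T\varphi_2]$, with image a Gaussian space. $\sigma(\Phi^{(k)})$ is the $\sigma$-algebra generated by the observations $[\phi^{(k)}_i,\xi]$, $i\in\mathcal I^{(k)}$. The conditional expectation of a field given a $\sigma$-algebra $\Sigma'$ is the field of conditional expectations: $[\varphi,\mathbb E[\xi\mid\Sigma']]:=\mathbb E[[\varphi,\xi]\mid\Sigma']$ for $\varphi\in\mathcal B^*$ (equalities a.s.). A sequence of fields $\xi^{(k)}$ is a martingale if $[\varphi,\xi^{(k)}]$ is a martingale for every $\varphi\in\mathcal B^*$; independence of fields means independence of the families of random variables indexed by $\varphi\in\mathcal B^*$. The last identity means $[\varphi,\xi^{(k)}]=\sum_{i\in\mathcal I^{(k)}}[\varphi,\psi^{(k)}_i][\phi^{(k)}_i,\xi]$ for every $\varphi\in\mathcal B^*$. *)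

theory Defs
  imports "HOL-Probability.Probability" "HOL-Library.Function_Algebras"
begin

type_synonym 'b dual = "'b \<Rightarrow>\<^sub>L real"

definition reflexive_space :: "'b::real_normed_vector itself \<Rightarrow> bool" where
  "reflexive_space _ \<longleftrightarrow>
     (\<forall>F :: 'b dual \<Rightarrow>\<^sub>L real. \<exists>u :: 'b. \<forall>\<phi>. blinfun_apply F \<phi> = blinfun_apply \<phi> u)"

definition symmetric_op :: "('b::real_normed_vector dual \<Rightarrow> 'b) \<Rightarrow> bool" where
  "symmetric_op T \<longleftrightarrow> (\<forall>\<phi> \<theta>. blinfun_apply \<phi> (T \<theta>) = blinfun_apply \<theta> (T \<phi>))"

definition positive_op :: "('b::real_normed_vector dual \<Rightarrow> 'b) \<Rightarrow> bool" where
  "positive_op T \<longleftrightarrow> (\<forall>\<phi>. \<phi> \<noteq> 0 \<longrightarrow> blinfun_apply \<phi> (T \<phi>) > 0)"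

definition nonnegative_op :: "('b::real_normed_vector dual \<Rightarrow> 'b) \<Rightarrow> bool" where
  "nonnegative_op T \<longleftrightarrow> (\<forall>\<phi>. blinfun_apply \<phi> (T \<phi>) \<ge> 0)"


text \<open>
  A \<open>q\<close>-tuple is a function that is \<open>undefined\<close> outside the positions \<open>1, \<dots>, q\<close>
  (all positive positions if \<open>q = \<infinity>\<close>), and the truncation of \<open>i\<close> to its first \<open>k\<close>
  entries is \<open>restrict i {1..k}\<close>. For finite \<open>q\<close>, truncation to level \<open>q\<close> is the identity
  on \<open>q\<close>-tuples. \<open>levels q\<close> is the range \<open>1 \<le> k \<le> q\<close> of finite levels.
\<close>

definition levels :: "enat \<Rightarrow> nat set" where
  "levels q = {k. 1 \<le> k \<and> enat k \<le> q}"

definition tree_level :: "(nat \<Rightarrow> 'i) set \<Rightarrow> nat \<Rightarrow> (nat \<Rightarrow> 'i) set" where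
  "tree_level I k = (\<lambda>i. restrict i {1..k}) ` I"

definition index_tree :: "enat \<Rightarrow> (nat \<Rightarrow> 'i) set \<Rightarrow> bool" where
  "index_tree q I \<longleftrightarrow>
     I \<subseteq> extensional (levels q) \<and>
     (case q of enat m \<Rightarrow> finite I | \<infinity> \<Rightarrow> (\<forall>k\<ge>1. finite (tree_level I k)))"

text \<open>
  The rank of an \<open>I \<times> J\<close> matrix as the dimension of its row space, inside the vector
  space of real functions with pointwise operations; rows are extended by \<open>0\<close> off \<open>J\<close>.
\<close>

definition matrix_rank :: "'a set \<Rightarrow> 'c set \<Rightarrow> ('a \<Rightarrow> 'c \<Rightarrow> real) \<Rightarrow> nat" where
  "matrix_rank I J A =
     vector_space.dim (\<lambda>(c::real) f j. c * f j) ((\<lambda>i j. if j \<in> J then A i j else 0) ` I)"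

definition independent_family :: "'a set \<Rightarrow> ('a \<Rightarrow> 'v::real_vector) \<Rightarrow> bool" where
  "independent_family I f \<longleftrightarrow> inj_on f I \<and> independent (f ` I)"

text \<open>
  \<open>\<phi> k i\<close> is the measurement function of label \<open>i\<close> at level \<open>k\<close>, and \<open>\<pi> k\<close> is the matrix
  passing from level \<open>k\<close> to level \<open>k + 1\<close>.
\<close>

definition nested_measurements ::
  "enat \<Rightarrow> (nat \<Rightarrow> 'i) set \<Rightarrow> (nat \<Rightarrow> (nat \<Rightarrow> 'i) \<Rightarrow> (nat \<Rightarrow> 'i) \<Rightarrow> real)
     \<Rightarrow> (nat \<Rightarrow> (nat \<Rightarrow> 'i) \<Rightarrow> 'b::real_normed_vector dual) \<Rightarrow> bool" where
  "nested_measurements q I \<pi> \<phi> \<longleftrightarrow>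
     (\<forall>k. k \<in> levels q \<and> Suc k \<in> levels q \<longrightarrow>
        matrix_rank (tree_level I k) (tree_level I (Suc k)) (\<pi> k) = card (tree_level I k) \<and>
        (\<forall>i\<in>tree_level I k. \<phi> k i = (\<Sum>j\<in>tree_level I (Suc k). \<pi> k i j *\<^sub>R \<phi> (Suc k) j))) \<and>
     (case q of
        enat m \<Rightarrow> independent_family I (\<phi> m)
      | \<infinity> \<Rightarrow> (\<forall>k\<ge>1. independent_family (tree_level I k) (\<phi> k)))"

definition gamblet :: "'a set \<Rightarrow> ('a \<Rightarrow> 'b::real_normed_vector dual) \<Rightarrow> 'a \<Rightarrow> 'b" where
  "gamblet I \<phi> i =
     (ARG_MIN norm \<psi>. \<forall>j\<in>I. blinfun_apply (\<phi> j) \<psi> = (if i = j then 1 else 0))"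


text \<open>
  A field is given by representatives: \<open>\<xi> \<phi> \<omega>\<close> is the value at \<open>\<omega>\<close> of a representative of the
  \<open>L\<^sup>2\<close>-class \<open>[\<phi>, \<xi>]\<close>. Accordingly, linearity in \<open>\<phi>\<close> and all equalities of fields are
  required almost surely only, for each fixed \<open>\<phi>\<close>.
\<close>

type_synonym ('b, 'w) field = "'b dual \<Rightarrow> 'w \<Rightarrow> real"

text \<open>The variance may be zero, in which case the variable vanishes almost surely.\<close>

definition centered_gaussian :: "'w measure \<Rightarrow> ('w \<Rightarrow> real) \<Rightarrow> bool" where
  "centered_gaussian M X \<longleftrightarrow>
     X \<in> borel_measurable M \<and>
     ((AE \<omega> in M. X \<omega> = 0) \<or>
      (\<exists>\<sigma>>0. distributed M lborel X (\<lambda>x. ennreal (normal_density 0 \<sigma> x))))"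

definition gaussian_field ::
  "'w measure \<Rightarrow> ('b::real_normed_vector dual \<Rightarrow> 'b) \<Rightarrow> ('b, 'w) field \<Rightarrow> bool" where
  "gaussian_field M T \<xi> \<longleftrightarrow>
     linear T \<and> symmetric_op T \<and> nonnegative_op T \<and>
     (\<forall>\<phi>. \<xi> \<phi> \<in> borel_measurable M \<and> integrable M (\<lambda>\<omega>. (\<xi> \<phi> \<omega>)\<^sup>2)) \<and>
     (\<forall>a b \<phi> \<theta>. AE \<omega> in M. \<xi> (a *\<^sub>R \<phi> + b *\<^sub>R \<theta>) \<omega> = a * \<xi> \<phi> \<omega> + b * \<xi> \<theta> \<omega>) \<and>
     (\<forall>\<phi> \<theta>. integral\<^sup>L M (\<lambda>\<omega>. \<xi> \<phi> \<omega> * \<xi> \<theta> \<omega>) = blinfun_apply \<phi> (T \<theta>)) \<and>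
     (\<forall>\<phi>. centered_gaussian M (\<xi> \<phi>))"

text \<open>
  The observations are \<open>L\<^sup>2\<close>-classes, so the events they generate are determined only up to
  null events. The null events are adjoined, which makes the \<open>\<sigma>\<close>-algebra independent
  of the choice of representatives.
\<close>

definition observation_algebra ::
  "'w measure \<Rightarrow> ('b::real_normed_vector, 'w) field \<Rightarrow> 'a set \<Rightarrow> ('a \<Rightarrow> 'b dual) \<Rightarrow> 'w measure" where
  "observation_algebra M \<xi> I \<phi> =
     sigma (space M)
       ({\<xi> (\<phi> i) -` A \<inter> space M |i A. i \<in> I \<and> A \<in> sets borel} \<union> null_sets M)"

definition cond_exp_field ::
  "'w measure \<Rightarrow> 'w measure \<Rightarrow> ('b::real_normed_vector, 'w) field \<Rightarrow> ('b, 'w) field" where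
  "cond_exp_field M F \<xi> = (\<lambda>\<phi>. real_cond_exp M F (\<xi> \<phi>))"

definition filtration_on :: "'w measure \<Rightarrow> nat set \<Rightarrow> (nat \<Rightarrow> 'w measure) \<Rightarrow> bool" where
  "filtration_on M K F \<longleftrightarrow>
     (\<forall>k\<in>K. subalgebra M (F k)) \<and> (\<forall>k\<in>K. \<forall>l\<in>K. k \<le> l \<longrightarrow> sets (F k) \<subseteq> sets (F l))"

definition martingale_on ::
  "'w measure \<Rightarrow> nat set \<Rightarrow> (nat \<Rightarrow> 'w measure) \<Rightarrow> (nat \<Rightarrow> 'w \<Rightarrow> real) \<Rightarrow> bool" where
  "martingale_on M K F X \<longleftrightarrow>
     (\<forall>k\<in>K. X k \<in> borel_measurable (F k) \<and> integrable M (X k)) \<and>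
     (\<forall>k\<in>K. \<forall>l\<in>K. k \<le> l \<longrightarrow> (AE \<omega> in M. X k \<omega> = real_cond_exp M (F k) (X l) \<omega>))"

definition increment_field ::
  "(nat \<Rightarrow> ('b::real_normed_vector, 'w) field) \<Rightarrow> nat \<Rightarrow> ('b, 'w) field" where
  "increment_field X k = (\<lambda>\<phi> \<omega>. X (Suc k) \<phi> \<omega> - X k \<phi> \<omega>)"

text \<open>
  A field is viewed as the random element \<open>\<omega> \<mapsto> (\<phi> \<mapsto> [\<phi>, \<xi>](\<omega>))\<close> of the product space over the
  dual, whose generated \<open>\<sigma>\<close>-algebra is that of the family of all its evaluations.
\<close>

definition independent_fields ::
  "'w measure \<Rightarrow> nat set \<Rightarrow> (nat \<Rightarrow> ('b::real_normed_vector, 'w) field) \<Rightarrow> bool" where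
  "independent_fields M K \<eta> \<longleftrightarrow>
     prob_space.indep_vars M (\<lambda>_. PiM (UNIV :: 'b dual set) (\<lambda>_. borel)) (\<lambda>k \<omega> \<phi>. \<eta> k \<phi> \<omega>) K"

end

theory Submission
  imports Defs
begin

text \<open>
  Let \<open>P k\<close> be the projection of the dual space onto \<open>span {\<phi> k i}\<close> that is orthogonal for the
  inner product \<open>[\<theta>, Q \<zeta>]\<close>. The gamblets are the images under \<open>Q\<close> of the dual basis of \<open>\<phi> k\<close>,
  so \<open>P k \<theta> = (\<Sum>i. [\<theta>, \<psi> k i] \<phi> k i)\<close>. Orthogonality in the dual space means
  independence of the corresponding Gaussian variables; hence \<open>\<xi> (\<theta> - P k \<theta>)\<close> is independent of
  the level \<open>k\<close> observations, and the conditional expectation of \<open>\<xi> \<theta>\<close> is \<open>\<xi> (P k \<theta>)\<close>. The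
  increments are \<open>\<xi> (P (k + 1) \<theta> - P k \<theta>)\<close>, and their arguments are orthogonal for different \<open>k\<close>.

  Independence follows from factorization of the joint characteristic function. Only the
  one-dimensional uniqueness theorem is needed, because exponentials can be replaced by
  indicators one coordinate at a time: the remaining factors act as a change of measure.
\<close>

section \<open>Independence from factorizing characteristic functions\<close>

text \<open>
  One-dimensional uniqueness of characteristic functions, applied to the law of \<open>X\<close> under the
  tilted probability measure with density \<open>1 + Z / d\<close>.
\<close>

lemma (in prob_space) integral_tilted_indicator_eq_zero:
  fixes Z X :: "'a \<Rightarrow> real"
  assumes [measurable]: "Z \<in> borel_measurable M" "X \<in> borel_measurable M" "A \<in> sets borel"
    and bound: "\<And>\<omega>. \<bar>Z \<omega>\<bar> \<le> c"
    and char_zero: "\<And>t. (CLINT \<omega>|M. of_real (Z \<omega>) * iexp (t * X \<omega>)) = 0"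
  shows "(LINT \<omega>|M. Z \<omega> * indicator A (X \<omega>)) = 0"
proof -
  \<comment> \<open>The summand \<open>1\<close> makes \<open>d\<close> positive even for
    \<open>c = 0\<close>, so that \<open>1 + Z / d\<close> is well defined and nonnegative.\<close>
  define d where "d = \<bar>c\<bar> + 1"
  have d: "d > 0" "\<And>\<omega>. \<bar>Z \<omega>\<bar> \<le> d"
    using bound by (auto simp: d_def intro: order_trans[OF _ abs_ge_self] add_increasing2)
      (metis add.commute add_increasing abs_ge_self order_trans zero_le_one)
  have intZ: "integrable M Z"
    by (rule integrable_const_bound[of _ d]) (use d in auto)
  \<comment> \<open>Frequency \<open>0\<close> shows that \<open>Z\<close> has mean zero, so the
    tilted density has total mass one.\<close>
  have [simp]: "(LINT \<omega>|M. Z \<omega>) = 0"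
    using char_zero[of 0] by simp
  define D where "D \<omega> = 1 + Z \<omega> / d" for \<omega>
  have [measurable]: "D \<in> borel_measurable M"
    unfolding D_def by measurable
  have D0: "D \<omega> \<ge> 0" for \<omega>
    using d(1) d(2)[of \<omega>] by (simp add: D_def field_simps abs_le_iff)
  have intD: "integrable M D" "(LINT \<omega>|M. D \<omega>) = 1"
    using intZ by (simp_all add: D_def[abs_def] prob_space)
  define N where "N = density M (\<lambda>\<omega>. ennreal (D \<omega>))"
  have "prob_space N"
    unfolding N_def
    by (rule prob_spaceI) (simp add: emeasure_density nn_integral_eq_integral intD D0 cong: nn_integral_cong)
  then interpret N: prob_space N .
  have [measurable]: "X \<in> borel_measurable N"
    by (simp add: N_def)
  have int_iexp: "integrable M (\<lambda>\<omega>. iexp (t * X \<omega>))" for t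
    by (rule integrable_const_bound[of _ 1]) auto
  have int_Z_iexp: "integrable M (\<lambda>\<omega>. of_real (Z \<omega>) * iexp (t * X \<omega>))" for t
    by (rule integrable_const_bound[of _ d]) (auto simp: norm_mult d)
  \<comment> \<open>The tilt changes the characteristic function of \<open>X\<close> only by the
    integral of \<open>Z\<close> times an exponential, divided by \<open>d\<close>, which vanishes
    by hypothesis. Equal laws give \<open>A\<close> equal probabilities, and their difference is the
    claimed integral divided by \<open>d\<close>.\<close>
  have "char (distr N borel X) = char (distr M borel X)"
  proof
    fix t
    have "char (distr N borel X) t = (CLINT \<omega>|N. iexp (t * X \<omega>))"
      by (simp add: char_def integral_distr)
    also have "\<dots> = (CLINT \<omega>|M. D \<omega> *\<^sub>R iexp (t * X \<omega>))"
      unfolding N_def by (subst integral_density) (auto simp: D0)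
    also have "\<dots> = (CLINT \<omega>|M. iexp (t * X \<omega>) + (of_real (Z \<omega>) * iexp (t * X \<omega>)) / of_real d)"
      by (rule Bochner_Integration.integral_cong) (auto simp: D_def scaleR_conv_of_real algebra_simps)
    also have "\<dots> = (CLINT \<omega>|M. iexp (t * X \<omega>))"
      using char_zero[of t] int_iexp int_Z_iexp by simp
    also have "\<dots> = char (distr M borel X) t"
      by (simp add: char_def integral_distr)
    finally show "char (distr N borel X) t = char (distr M borel X) t" .
  qed
  then have "distr N borel X = distr M borel X"
    by (intro Levy_uniqueness N.real_distribution_distr real_distribution_distr) auto
  then have "(LINT x|distr N borel X. indicator A x) = (LINT x|distr M borel X. (indicator A x :: real))"
    by simp
  then have "(LINT \<omega>|N. indicator A (X \<omega>)) = (LINT \<omega>|M. (indicator A (X \<omega>) :: real))"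
    by (subst (asm) (1 2) integral_distr) auto
  moreover have "(LINT \<omega>|N. indicator A (X \<omega>)) = (LINT \<omega>|M. D \<omega> *\<^sub>R (indicator A (X \<omega>) :: real))"
    unfolding N_def by (subst integral_density) (auto simp: D0)
  moreover have "\<dots> = (LINT \<omega>|M. indicator A (X \<omega>) + Z \<omega> * indicator A (X \<omega>) / d)"
    by (rule Bochner_Integration.integral_cong) (auto simp: D_def algebra_simps)
  moreover have "\<dots> = (LINT \<omega>|M. indicator A (X \<omega>)) + (LINT \<omega>|M. Z \<omega> * indicator A (X \<omega>)) / d"
  proof -
    have "integrable M (\<lambda>\<omega>. indicator A (X \<omega>) :: real)"
      by (rule integrable_const_bound[of _ 1]) auto
    moreover have "integrable M (\<lambda>\<omega>. Z \<omega> * indicator A (X \<omega>))"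
      by (rule integrable_const_bound[of _ d]) (use d in \<open>auto simp: abs_mult indicator_def\<close>)
    ultimately show ?thesis by simp
  qed
  ultimately show ?thesis
    using d(1) by simp
qed

lemma Re_mult_indicator: "Re (z * indicator A x) = Re z * indicator A x"
  and Im_mult_indicator: "Im (z * indicator A x) = Im z * indicator A x"
  by (simp_all add: indicator_def)

text \<open>Reduction to real weights: the real and imaginary parts of \<open>Z\<close> are
  combinations of \<open>Z\<close> and its conjugate, and the hypothesis at \<open>-t\<close>,
  conjugated, covers the conjugate weight.\<close>

lemma (in prob_space) integral_complex_indicator_eq_zero:
  fixes Z :: "'a \<Rightarrow> complex" and X :: "'a \<Rightarrow> real"
  assumes [measurable]: "Z \<in> borel_measurable M" "X \<in> borel_measurable M" "A \<in> sets borel"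
    and bound: "\<And>\<omega>. norm (Z \<omega>) \<le> c"
    and char_zero: "\<And>t. (CLINT \<omega>|M. Z \<omega> * iexp (t * X \<omega>)) = 0"
  shows "(CLINT \<omega>|M. Z \<omega> * indicator A (X \<omega>)) = 0"
proof -
  have int: "integrable M (\<lambda>\<omega>. Z \<omega> * iexp (t * X \<omega>))" for t
    by (rule integrable_const_bound[of _ c]) (auto simp: norm_mult bound)
  have [measurable]: "(\<lambda>\<omega>. cnj (Z \<omega>)) \<in> borel_measurable M"
    by (rule measurable_compose[OF assms(1) borel_measurable_continuous_onI]) (intro continuous_intros)
  have int': "integrable M (\<lambda>\<omega>. cnj (Z \<omega>) * iexp (t * X \<omega>))" for t
    by (rule integrable_const_bound[of _ c]) (auto simp: norm_mult bound)
  have char_zero': "(CLINT \<omega>|M. cnj (Z \<omega>) * iexp (t * X \<omega>)) = 0" for t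
  proof -
    have "(CLINT \<omega>|M. cnj (Z \<omega>) * iexp (t * X \<omega>)) = (CLINT \<omega>|M. cnj (Z \<omega> * iexp (- t * X \<omega>)))"
      by (simp add: exp_cnj)
    also have "\<dots> = cnj (CLINT \<omega>|M. Z \<omega> * iexp (- t * X \<omega>))"
      by (rule Bochner_Integration.integral_cnj)
    finally show ?thesis
      using char_zero[of "-t"] by simp
  qed
  have "(LINT \<omega>|M. Re (Z \<omega>) * indicator A (X \<omega>)) = 0"
  proof (rule integral_tilted_indicator_eq_zero[where c = c])
    show "\<bar>Re (Z \<omega>)\<bar> \<le> c" for \<omega>
      using abs_Re_le_cmod bound order_trans by blast
    fix t
    have "(CLINT \<omega>|M. of_real (Re (Z \<omega>)) * iexp (t * X \<omega>)) =
        (CLINT \<omega>|M. (Z \<omega> * iexp (t * X \<omega>) + cnj (Z \<omega>) * iexp (t * X \<omega>)) / 2)"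
      by (rule Bochner_Integration.integral_cong)
        (auto simp: complex_add_cnj simp flip: distrib_right)
    then show "(CLINT \<omega>|M. of_real (Re (Z \<omega>)) * iexp (t * X \<omega>)) = 0"
      using int int' char_zero char_zero' by simp
  qed auto
  moreover have "(LINT \<omega>|M. Im (Z \<omega>) * indicator A (X \<omega>)) = 0"
  proof (rule integral_tilted_indicator_eq_zero[where c = c])
    show "\<bar>Im (Z \<omega>)\<bar> \<le> c" for \<omega>
      using abs_Im_le_cmod bound order_trans by blast
    fix t
    have "(CLINT \<omega>|M. of_real (Im (Z \<omega>)) * iexp (t * X \<omega>)) =
        (CLINT \<omega>|M. (Z \<omega> * iexp (t * X \<omega>) - cnj (Z \<omega>) * iexp (t * X \<omega>)) / (2 * \<i>))"
    proof (rule Bochner_Integration.integral_cong)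
      fix \<omega>
      have "complex_of_real (Im (Z \<omega>)) = (Z \<omega> - cnj (Z \<omega>)) / (2 * \<i>)"
        by (simp add: complex_eq_iff)
      then show "of_real (Im (Z \<omega>)) * iexp (t * X \<omega>) =
          (Z \<omega> * iexp (t * X \<omega>) - cnj (Z \<omega>) * iexp (t * X \<omega>)) / (2 * \<i>)"
        by (simp only: left_diff_distrib[symmetric] times_divide_eq_left)
    qed simp
    then show "(CLINT \<omega>|M. of_real (Im (Z \<omega>)) * iexp (t * X \<omega>)) = 0"
      using int int' char_zero char_zero' by simp
  qed auto
  moreover have "integrable M (\<lambda>\<omega>. Z \<omega> * indicator A (X \<omega>))"
    by (rule integrable_const_bound[of _ c])
      (use bound in \<open>auto simp: norm_mult indicator_def intro: order_trans[OF norm_ge_zero bound]\<close>)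
  ultimately show ?thesis
    by (simp add: complex_eq_iff integral_Re[symmetric] integral_Im[symmetric] Re_mult_indicator Im_mult_indicator
      del: times_complex.sel)
qed

text \<open>Exchanges exponentials for indicators one coordinate at a time. The weight is arbitrary
  in the induction because the indicator of the new coordinate is absorbed into it.\<close>

lemma (in prob_space) integral_prod_indicator_eq_zero:
  fixes Z :: "'a \<Rightarrow> complex" and Y :: "'s \<Rightarrow> 'a \<Rightarrow> real"
  assumes "finite S"
    and "Z \<in> borel_measurable M" "\<And>\<omega>. norm (Z \<omega>) \<le> c"
    and "\<And>s. s \<in> S \<Longrightarrow> Y s \<in> borel_measurable M" "\<And>s. s \<in> S \<Longrightarrow> B s \<in> sets borel"
    and "\<And>a. (CLINT \<omega>|M. Z \<omega> * iexp (\<Sum>s\<in>S. a s * Y s \<omega>)) = 0"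
  shows "(CLINT \<omega>|M. Z \<omega> * (\<Prod>s\<in>S. indicator (B s) (Y s \<omega>))) = 0"
  using assms
proof (induction S arbitrary: Z rule: finite_induct)
  case empty
  then show ?case by simp
next
  case (insert r S)
  note [measurable] = insert.prems(1) insert.prems(3,4)
  have [measurable]: "Y r \<in> borel_measurable M" "B r \<in> sets borel"
    "(\<lambda>\<omega>. \<Sum>s\<in>S. a s * Y s \<omega>) \<in> borel_measurable M" for a
    by (auto intro!: borel_measurable_sum borel_measurable_times insert.prems)
  have "(CLINT \<omega>|M. (Z \<omega> * indicator (B r) (Y r \<omega>)) * (\<Prod>s\<in>S. indicator (B s) (Y s \<omega>))) = 0"
  proof (rule insert.IH)
    show "norm (Z \<omega> * indicator (B r) (Y r \<omega>)) \<le> c" for \<omega>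
      using insert.prems(2)[of \<omega>] order_trans[OF norm_ge_zero insert.prems(2)[of \<omega>]]
      by (auto simp: norm_mult indicator_def)
    fix a
    \<comment> \<open>The exponential in the coordinates of \<open>S\<close> joins the weight,
      leaving a one-dimensional problem in \<open>Y r\<close>; its frequency \<open>t\<close> enters
      the hypothesis through \<open>a(r := t)\<close>.\<close>
    have "(CLINT \<omega>|M. (Z \<omega> * iexp (\<Sum>s\<in>S. a s * Y s \<omega>)) * indicator (B r) (Y r \<omega>)) = 0"
    proof (rule integral_complex_indicator_eq_zero[where c = c])
      show "norm (Z \<omega> * iexp (\<Sum>s\<in>S. a s * Y s \<omega>)) \<le> c" for \<omega>
        using insert.prems(2)[of \<omega>] by (simp add: norm_mult del: of_real_sum)
      fix t
      have sum_eq: "(\<Sum>s\<in>insert r S. (a(r := t)) s * Y s \<omega>) = (\<Sum>s\<in>S. a s * Y s \<omega>) + t * Y r \<omega>" for \<omega>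
      proof -
        have "(\<Sum>s\<in>S. (a(r := t)) s * Y s \<omega>) = (\<Sum>s\<in>S. a s * Y s \<omega>)"
          using insert.hyps by (intro sum.cong) auto
        then show ?thesis using insert.hyps by simp
      qed
      show "(CLINT \<omega>|M. (Z \<omega> * iexp (\<Sum>s\<in>S. a s * Y s \<omega>)) * iexp (t * Y r \<omega>)) = 0"
        using insert.prems(5)[of "a(r := t)"] unfolding sum_eq
        by (simp add: exp_add distrib_left mult.assoc del: of_real_sum)
    qed auto
    then show "(CLINT \<omega>|M. (Z \<omega> * indicator (B r) (Y r \<omega>)) * iexp (\<Sum>s\<in>S. a s * Y s \<omega>)) = 0"
      by (simp add: mult_ac del: of_real_sum)
  qed (use insert.prems in auto)
  then show ?case
    using insert.hyps by (simp add: mult_ac)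
qed

lemma (in prob_space) integral_complex_indicator:
  assumes "A \<in> events"
  shows "(CLINT \<omega>|M. indicator A \<omega>) = of_real (prob A)"
proof -
  have "(CLINT \<omega>|M. indicator A \<omega>) = (CLINT \<omega>|M. of_real (indicator A \<omega>))"
    by (rule Bochner_Integration.integral_cong) (auto simp: indicator_def)
  also have "\<dots> = of_real (LINT \<omega>|M. indicator A \<omega>)"
    by (rule integral_complex_of_real)
  finally show ?thesis
    using assms by simp
qed

text \<open>A block is a finite family of coordinates. Hybrid products, partly indicators and partly
  exponentials, lead from the factorization of exponentials to that of cylinder
  probabilities.\<close>

lemma (in prob_space) prob_blocks_factorize:
  fixes Y :: "'j \<Rightarrow> 's \<Rightarrow> 'a \<Rightarrow> real"
  assumes J: "finite J" and T: "\<And>j. j \<in> J \<Longrightarrow> finite (T j)"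
    and Y: "\<And>j s. j \<in> J \<Longrightarrow> s \<in> T j \<Longrightarrow> Y j s \<in> borel_measurable M"
    and B: "\<And>j s. j \<in> J \<Longrightarrow> s \<in> T j \<Longrightarrow> B j s \<in> sets borel"
    and factor: "\<And>c. (CLINT \<omega>|M. (\<Prod>j\<in>J. iexp (\<Sum>s\<in>T j. c j s * Y j s \<omega>))) =
        (\<Prod>j\<in>J. CLINT \<omega>|M. iexp (\<Sum>s\<in>T j. c j s * Y j s \<omega>))"
  shows "prob {\<omega>\<in>space M. \<forall>j\<in>J. \<forall>s\<in>T j. Y j s \<omega> \<in> B j s} =
    (\<Prod>j\<in>J. prob {\<omega>\<in>space M. \<forall>s\<in>T j. Y j s \<omega> \<in> B j s})"
proof -
  define ind :: "'j \<Rightarrow> 'a \<Rightarrow> complex"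
    where "ind j \<omega> = (\<Prod>s\<in>T j. indicator (B j s) (Y j s \<omega>))" for j \<omega>
  define e where "e f j \<omega> = iexp (\<Sum>s\<in>T j. f s * Y j s \<omega>)" for f j \<omega>
  define V where "V D c j = (if j \<in> D then ind j else e (c j) j)" for D c j
  have ind_meas: "ind j \<in> borel_measurable M" if "j \<in> J" for j
    unfolding ind_def using Y[OF that] B[OF that]
    by (intro borel_measurable_prod measurable_compose[OF _ borel_measurable_indicator]) auto
  have e_meas: "e f j \<in> borel_measurable M" if "j \<in> J" for f j
  proof -
    have [measurable]: "(\<lambda>\<omega>. \<Sum>s\<in>T j. f s * Y j s \<omega>) \<in> borel_measurable M"
      using Y[OF that] by (intro borel_measurable_sum borel_measurable_times) auto
    show ?thesis unfolding e_def[abs_def] by (measurable)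
  qed
  have V_meas: "V D c j \<in> borel_measurable M" if "j \<in> J" for D c j
    using ind_meas e_meas that by (simp add: V_def)
  have ind_le: "norm (ind j \<omega>) \<le> 1" for j \<omega>
    unfolding ind_def prod_norm[symmetric]
    by (intro prod_le_1) (auto simp: indicator_def)
  have V_le: "norm (V D c j \<omega>) \<le> 1" for D c j \<omega>
    using ind_le by (simp add: V_def e_def del: of_real_sum)
  have e_norm: "norm (e f j \<omega>) = 1" for f j \<omega>
    by (simp add: e_def del: of_real_sum)
  \<comment> \<open>The blocks in \<open>D\<close> already carry indicators instead of exponentials; \<open>D\<close> grows one block at a time.\<close>
  have main: "D \<subseteq> J \<Longrightarrow> \<forall>c. (CLINT \<omega>|M. (\<Prod>j\<in>J. V D c j \<omega>)) = (\<Prod>j\<in>J. CLINT \<omega>|M. V D c j \<omega>)" for D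
  proof (induction "D" rule: infinite_finite_induct)
    case (infinite A)
    then show ?case using J finite_subset by blast
  next
    case empty
    then show ?case using factor by (simp add: V_def e_def del: of_real_sum)
  next
    case (insert k D)
    show ?case
    proof
      fix c :: "'j \<Rightarrow> 's \<Rightarrow> real"
      have k: "k \<in> J" "k \<notin> D" using insert by auto
      \<comment> \<open>\<open>W\<close> collects the blocks other than \<open>k\<close>, and
        \<open>p\<close> is the product of their means. The aim is that \<open>W - p\<close>
        integrates to zero against the indicator of block \<open>k\<close>.\<close>
      define W where "W \<omega> = (\<Prod>j\<in>J-{k}. V D c j \<omega>)" for \<omega>
      define p where "p = (\<Prod>j\<in>J-{k}. CLINT \<omega>|M. V D c j \<omega>)"
      have [measurable]: "W \<in> borel_measurable M"
        unfolding W_def[abs_def] using V_meas by (intro borel_measurable_prod) auto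
      have W_le: "norm (W \<omega>) \<le> 1" for \<omega>
        unfolding W_def prod_norm[symmetric] using V_le by (intro prod_le_1) auto
      \<comment> \<open>Block \<open>k\<close> is not in \<open>D\<close>, so it still carries an
        exponential whose frequencies can be chosen freely; this is why the induction claim is for
        all \<open>c\<close>.\<close>
      have W_e: "(CLINT \<omega>|M. e f k \<omega> * W \<omega>) = (CLINT \<omega>|M. e f k \<omega>) * p" for f
      proof -
        have *: "V D (c(k := f)) j = V D c j" if "j \<noteq> k" for j
          using that by (simp add: V_def)
        have **: "V D (c(k := f)) k = e f k"
          using k by (simp add: V_def)
        have "(CLINT \<omega>|M. (\<Prod>j\<in>J. V D (c(k := f)) j \<omega>)) = (\<Prod>j\<in>J. CLINT \<omega>|M. V D (c(k := f)) j \<omega>)"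
          using insert.IH insert.prems by blast
        then show ?thesis
          unfolding prod.remove[OF J k(1)] ** by (simp add: * W_def p_def)
      qed
      have W_p: "(CLINT \<omega>|M. W \<omega>) = p"
        using W_e[of "\<lambda>_. 0"] by (simp add: e_def prob_space)
      \<comment> \<open>By \<open>W_e\<close> the weight \<open>W - p\<close> has zero integral
        against every exponential of block \<open>k\<close>, hence against its indicator.\<close>
      have "(CLINT \<omega>|M. (W \<omega> - p) * ind k \<omega>) = 0"
        unfolding ind_def
      proof (rule integral_prod_indicator_eq_zero[where c = "1 + norm p"])
        show "norm (W \<omega> - p) \<le> 1 + norm p" for \<omega>
          using norm_triangle_ineq4[of "W \<omega>" p] W_le[of \<omega>] by linarith
        fix f
        have "integrable M (\<lambda>\<omega>. e f k \<omega> * W \<omega>)"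
          by (rule integrable_const_bound[of _ 1])
            (use e_meas[OF k(1)] W_le e_norm in \<open>auto simp: norm_mult\<close>)
        moreover have "integrable M (e f k)"
          by (rule integrable_const_bound[of _ 1])
            (use e_meas[OF k(1)] e_norm in auto)
        moreover have "(CLINT \<omega>|M. (W \<omega> - p) * e f k \<omega>) = (CLINT \<omega>|M. e f k \<omega> * W \<omega> - e f k \<omega> * p)"
          by (simp add: algebra_simps)
        ultimately show "(CLINT \<omega>|M. (W \<omega> - p) * iexp (\<Sum>s\<in>T k. f s * Y k s \<omega>)) = 0"
          using W_e[of f] by (simp add: e_def[symmetric] del: of_real_sum)
      qed (use T Y B k in auto)
      moreover have "integrable M (\<lambda>\<omega>. ind k \<omega> * W \<omega>)"
        by (rule integrable_const_bound[of _ 1])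
          (use ind_meas[OF k(1)] W_le ind_le in \<open>auto simp: norm_mult intro!: mult_le_one\<close>)
      moreover have "integrable M (ind k)"
        by (rule integrable_const_bound[of _ 1]) (use ind_meas[OF k(1)] ind_le in auto)
      moreover have "(CLINT \<omega>|M. (W \<omega> - p) * ind k \<omega>) = (CLINT \<omega>|M. ind k \<omega> * W \<omega> - ind k \<omega> * p)"
        by (simp add: algebra_simps)
      ultimately have W_ind: "(CLINT \<omega>|M. ind k \<omega> * W \<omega>) = (CLINT \<omega>|M. ind k \<omega>) * p"
        by simp
      have *: "V (insert k D) c j = V D c j" if "j \<noteq> k" for j
        using that by (simp add: V_def)
      have **: "V (insert k D) c k = ind k"
        by (simp add: V_def)
      show "(CLINT \<omega>|M. (\<Prod>j\<in>J. V (insert k D) c j \<omega>)) = (\<Prod>j\<in>J. CLINT \<omega>|M. V (insert k D) c j \<omega>)"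
        using W_ind unfolding prod.remove[OF J k(1)] ** by (simp add: * W_def p_def)
    qed
  qed
  have sets: "{\<omega>\<in>space M. \<forall>s\<in>T j. Y j s \<omega> \<in> B j s} \<in> events" if "j \<in> J" for j
    using T[OF that] Y[OF that] B[OF that] by (intro sets.sets_Collect_finite_All) (auto intro: measurable_sets_Collect)
  have ind_eq: "ind j \<omega> = indicator {\<omega>\<in>space M. \<forall>s\<in>T j. Y j s \<omega> \<in> B j s} \<omega>"
    if "j \<in> J" "\<omega> \<in> space M" for j \<omega>
    using that T by (auto simp: ind_def indicator_def)
  have int_ind: "(CLINT \<omega>|M. ind j \<omega>) = prob {\<omega>\<in>space M. \<forall>s\<in>T j. Y j s \<omega> \<in> B j s}" if "j \<in> J" for j
  proof -
    have "(CLINT \<omega>|M. ind j \<omega>) = (CLINT \<omega>|M. indicator {\<omega>\<in>space M. \<forall>s\<in>T j. Y j s \<omega> \<in> B j s} \<omega>)"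
      by (rule Bochner_Integration.integral_cong) (auto simp: ind_eq that)
    then show ?thesis
      using sets[OF that] by (simp only: integral_complex_indicator)
  qed
  have "(CLINT \<omega>|M. (\<Prod>j\<in>J. ind j \<omega>)) =
      (CLINT \<omega>|M. indicator {\<omega>\<in>space M. \<forall>j\<in>J. \<forall>s\<in>T j. Y j s \<omega> \<in> B j s} \<omega>)"
    by (rule Bochner_Integration.integral_cong) (use J in \<open>auto simp: ind_eq indicator_def\<close>)
  also have "\<dots> = prob {\<omega>\<in>space M. \<forall>j\<in>J. \<forall>s\<in>T j. Y j s \<omega> \<in> B j s}"
  proof -
    have "{\<omega>\<in>space M. \<forall>j\<in>J. \<forall>s\<in>T j. Y j s \<omega> \<in> B j s} \<in> events"
      using J T Y B by (intro sets.sets_Collect_finite_All) (auto intro: measurable_sets_Collect)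
    then show ?thesis by (rule integral_complex_indicator)
  qed
  \<comment> \<open>For \<open>D = J\<close> every block carries its indicator.\<close>
  finally have "complex_of_real (prob {\<omega>\<in>space M. \<forall>j\<in>J. \<forall>s\<in>T j. Y j s \<omega> \<in> B j s}) =
      of_real (\<Prod>j\<in>J. prob {\<omega>\<in>space M. \<forall>s\<in>T j. Y j s \<omega> \<in> B j s})"
    using main[of J] by (simp add: V_def int_ind cong: prod.cong)
  then show ?thesis
    by (simp only: of_real_eq_iff)
qed

text \<open>Cylinder events with finitely many constraints form an intersection-stable generator of
  each product \<sigma>-algebra, so finite subfamilies decide independence even when
  \<open>K\<close> and the \<open>S j\<close> are infinite.\<close>

lemma (in prob_space) indep_vars_if_char_factorizes:
  fixes Y :: "'j \<Rightarrow> 's \<Rightarrow> 'a \<Rightarrow> real"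
  assumes Y: "\<And>j s. j \<in> K \<Longrightarrow> s \<in> S j \<Longrightarrow> Y j s \<in> borel_measurable M"
    and factor: "\<And>J T c. finite J \<Longrightarrow> J \<subseteq> K \<Longrightarrow> (\<And>j. j \<in> J \<Longrightarrow> finite (T j) \<and> T j \<subseteq> S j) \<Longrightarrow>
        (CLINT \<omega>|M. (\<Prod>j\<in>J. iexp (\<Sum>s\<in>T j. c j s * Y j s \<omega>))) =
        (\<Prod>j\<in>J. CLINT \<omega>|M. iexp (\<Sum>s\<in>T j. c j s * Y j s \<omega>))"
  shows "indep_vars (\<lambda>j. PiM (S j) (\<lambda>_. borel)) (\<lambda>j \<omega>. \<lambda>s\<in>S j. Y j s \<omega>) K"
proof -
  let ?X = "\<lambda>j \<omega>. \<lambda>s\<in>S j. Y j s \<omega>"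
  let ?P = "\<lambda>j. prod_algebra (S j) (\<lambda>_. borel :: real measure)"
  let ?G = "\<lambda>j. {?X j -` A \<inter> space M | A. A \<in> ?P j}"
  have rv: "?X j \<in> measurable M (PiM (S j) (\<lambda>_. borel))" if "j \<in> K" for j
    using Y[OF that] by (intro measurable_restrict)
  have gen: "{?X j -` A \<inter> space M | A. A \<in> sets (PiM (S j) (\<lambda>_. borel))} = sigma_sets (space M) (?G j)" for j
    unfolding sets_PiM by (rule sigma_sets_vimage_commute) (auto simp: PiE_def)
  have "indep_sets ?G K"
  proof (rule indep_setsI)
    show "?G j \<subseteq> events" if "j \<in> K" for j
      using measurable_sets[OF rv[OF that]] by (auto simp: sets_PiM)
    fix A J
    assume J: "J \<noteq> {}" "J \<subseteq> K" "finite J" and A: "\<forall>j\<in>J. A j \<in> ?G j"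
    have "\<forall>j\<in>J. \<exists>T B. finite T \<and> T \<subseteq> S j \<and> (\<forall>s\<in>T. B s \<in> sets borel) \<and>
        A j = {\<omega>\<in>space M. \<forall>s\<in>T. Y j s \<omega> \<in> B s}"
    proof
      fix j assume "j \<in> J"
      then have "A j \<in> ?G j"
        using A by blast
      then obtain C where C: "C \<in> ?P j" "A j = ?X j -` C \<inter> space M"
        by (elim CollectE exE conjE)
      obtain T B where TB: "C = prod_emb (S j) (\<lambda>_. borel) T (\<Pi>\<^sub>E s\<in>T. B s)" "finite T" "T \<subseteq> S j"
          "\<And>s. s \<in> T \<Longrightarrow> B s \<in> sets borel"
        using C(1) by (rule prod_algebraE) (rule that)
      have "A j = {\<omega>\<in>space M. \<forall>s\<in>T. Y j s \<omega> \<in> B s}"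
        unfolding C(2) TB(1) using TB(3)
        by (auto simp: prod_emb_def PiE_iff extensional_def subset_iff)
      then show "\<exists>T B. finite T \<and> T \<subseteq> S j \<and> (\<forall>s\<in>T. B s \<in> sets borel) \<and>
          A j = {\<omega>\<in>space M. \<forall>s\<in>T. Y j s \<omega> \<in> B s}"
        using TB by (intro exI[of _ T] exI[of _ B]) auto
    qed
    then obtain T where "\<forall>j\<in>J. \<exists>B. finite (T j) \<and> T j \<subseteq> S j \<and> (\<forall>s\<in>T j. B s \<in> sets borel) \<and>
        A j = {\<omega>\<in>space M. \<forall>s\<in>T j. Y j s \<omega> \<in> B s}"
      by (rule bchoice[THEN exE])
    then obtain B where "\<forall>j\<in>J. finite (T j) \<and> T j \<subseteq> S j \<and> (\<forall>s\<in>T j. B j s \<in> sets borel) \<and>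
        A j = {\<omega>\<in>space M. \<forall>s\<in>T j. Y j s \<omega> \<in> B j s}"
      by (rule bchoice[THEN exE])
    then have TB: "\<And>j. j \<in> J \<Longrightarrow> finite (T j) \<and> T j \<subseteq> S j"
        "\<And>j s. j \<in> J \<Longrightarrow> s \<in> T j \<Longrightarrow> B j s \<in> sets borel"
        "\<And>j. j \<in> J \<Longrightarrow> A j = {\<omega>\<in>space M. \<forall>s\<in>T j. Y j s \<omega> \<in> B j s}"
      by simp_all
    have "(\<Inter>j\<in>J. A j) = {\<omega>\<in>space M. \<forall>j\<in>J. \<forall>s\<in>T j. Y j s \<omega> \<in> B j s}"
      using J(1) TB(3) by auto
    moreover have "prob {\<omega>\<in>space M. \<forall>j\<in>J. \<forall>s\<in>T j. Y j s \<omega> \<in> B j s} =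
        (\<Prod>j\<in>J. prob {\<omega>\<in>space M. \<forall>s\<in>T j. Y j s \<omega> \<in> B j s})"
    proof (rule prob_blocks_factorize[OF J(3)])
      show "(CLINT \<omega>|M. (\<Prod>j\<in>J. iexp (\<Sum>s\<in>T j. c j s * Y j s \<omega>))) =
          (\<Prod>j\<in>J. CLINT \<omega>|M. iexp (\<Sum>s\<in>T j. c j s * Y j s \<omega>))" for c
        by (rule factor[OF J(3,2) TB(1)])
      show "Y j s \<in> borel_measurable M" if "j \<in> J" "s \<in> T j" for j s
        using Y[of j s] TB(1)[of j] J(2) that by blast
    qed (use TB(1,2) in auto)
    moreover have "(\<Prod>j\<in>J. prob (A j)) = (\<Prod>j\<in>J. prob {\<omega>\<in>space M. \<forall>s\<in>T j. Y j s \<omega> \<in> B j s})"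
      by (rule prod.cong) (simp_all add: TB(3))
    ultimately show "prob (\<Inter>j\<in>J. A j) = (\<Prod>j\<in>J. prob (A j))"
      by (simp only:)
  qed
  moreover have "Int_stable (?G j)" for j
  proof (rule Int_stableI)
    fix a b assume ab: "a \<in> ?G j" "b \<in> ?G j"
    obtain A where A: "A \<in> ?P j" "a = ?X j -` A \<inter> space M"
      using ab(1) by (elim CollectE exE conjE)
    obtain B where B: "B \<in> ?P j" "b = ?X j -` B \<inter> space M"
      using ab(2) by (elim CollectE exE conjE)
    have "A \<inter> B \<in> ?P j"
      by (rule Int_stableD[OF Int_stable_prod_algebra A(1) B(1)])
    moreover have "a \<inter> b = ?X j -` (A \<inter> B) \<inter> space M"
      unfolding A(2) B(2) by auto
    ultimately show "a \<inter> b \<in> ?G j"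
      by (intro CollectI exI[of _ "A \<inter> B"] conjI)
  qed
  ultimately have "indep_sets (\<lambda>j. sigma_sets (space M) (?G j)) K"
    by (rule indep_sets_sigma)
  then show ?thesis
    unfolding indep_vars_def2 gen using rv by simp
qed

section \<open>Orthogonality and independence in a Gaussian field\<close>

lemma (in prob_space) gaussian_fieldD:
  assumes "gaussian_field M Q \<xi>"
  shows "linear Q" "symmetric_op Q" "\<xi> \<theta> \<in> borel_measurable M" "integrable M (\<lambda>\<omega>. (\<xi> \<theta> \<omega>)\<^sup>2)"
    and "AE \<omega> in M. \<xi> (a *\<^sub>R \<theta> + b *\<^sub>R \<zeta>) \<omega> = a * \<xi> \<theta> \<omega> + b * \<xi> \<zeta> \<omega>"
    and "(LINT \<omega>|M. \<xi> \<theta> \<omega> * \<xi> \<zeta> \<omega>) = blinfun_apply \<theta> (Q \<zeta>)"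
    and "centered_gaussian M (\<xi> \<theta>)"
    and "integrable M (\<xi> \<theta>)"
proof -
  show "\<xi> \<theta> \<in> borel_measurable M" "integrable M (\<lambda>\<omega>. (\<xi> \<theta> \<omega>)\<^sup>2)"
    using assms by (auto simp: gaussian_field_def)
  then show "integrable M (\<xi> \<theta>)"
    by (rule square_integrable_imp_integrable)
qed (use assms in \<open>auto simp: gaussian_field_def\<close>)

text \<open>Linearity of a field holds only almost surely and for each pair of arguments, so finite
  sums need an induction that collects the exceptional null sets.\<close>

lemma (in prob_space) gaussian_field_sum:
  assumes \<xi>: "gaussian_field M Q \<xi>" and "finite S"
  shows "AE \<omega> in M. \<xi> (\<Sum>s\<in>S. c s *\<^sub>R f s) \<omega> = (\<Sum>s\<in>S. c s * \<xi> (f s) \<omega>)"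
  using \<open>finite S\<close>
proof induction
  case empty
  \<comment> \<open>With both coefficients zero, linearity yields \<open>\<xi> 0 = 0\<close> almost
    surely.\<close>
  show ?case
    using gaussian_fieldD(5)[OF \<xi>, of 0 0 0 0] by simp
next
  case (insert s S)
  have "AE \<omega> in M. \<xi> (c s *\<^sub>R f s + 1 *\<^sub>R (\<Sum>s\<in>S. c s *\<^sub>R f s)) \<omega> =
      c s * \<xi> (f s) \<omega> + 1 * \<xi> (\<Sum>s\<in>S. c s *\<^sub>R f s) \<omega>"
    by (rule gaussian_fieldD(5)[OF \<xi>])
  with insert.IH show ?case
    by eventually_elim (use insert.hyps in simp)
qed

lemma (in prob_space) gaussian_field_expectation:
  assumes \<xi>: "gaussian_field M Q \<xi>"
  shows "expectation (\<xi> \<theta>) = 0"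
proof -
  have "centered_gaussian M (\<xi> \<theta>)"
    by (rule gaussian_fieldD[OF \<xi>])
  then show ?thesis
    unfolding centered_gaussian_def
    by (auto intro: normal_distributed_expectation integral_eq_zero_AE)
qed

text \<open>The covariance identity determines the variance. The degenerate variable is almost
  surely zero, and the other case is scaled to the standard normal law.\<close>

lemma (in prob_space) gaussian_field_char:
  assumes \<xi>: "gaussian_field M Q \<xi>"
  shows "(CLINT \<omega>|M. iexp (\<xi> \<theta> \<omega>)) = of_real (exp (- blinfun_apply \<theta> (Q \<theta>) / 2))"
proof -
  note [measurable] = gaussian_fieldD(3)[OF \<xi>]
  have var: "blinfun_apply \<theta> (Q \<theta>) = (LINT \<omega>|M. (\<xi> \<theta> \<omega>)\<^sup>2)"
    using gaussian_fieldD(6)[OF \<xi>, of \<theta> \<theta>] by (simp add: power2_eq_square)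
  consider "AE \<omega> in M. \<xi> \<theta> \<omega> = 0"
    | \<sigma> where "\<sigma> > 0" "distributed M lborel (\<xi> \<theta>) (\<lambda>x. ennreal (normal_density 0 \<sigma> x))"
    using gaussian_fieldD(7)[OF \<xi>, of \<theta>] by (auto simp: centered_gaussian_def)
  then show ?thesis
  proof cases
    case 1
    then have "blinfun_apply \<theta> (Q \<theta>) = 0"
      unfolding var by (intro integral_eq_zero_AE) auto
    moreover have "(CLINT \<omega>|M. iexp (\<xi> \<theta> \<omega>)) = (CLINT \<omega>|M. 1)"
      using 1 by (intro integral_cong_AE) auto
    ultimately show ?thesis by (simp add: prob_space)
  next
    case 2
    have \<sigma>: "blinfun_apply \<theta> (Q \<theta>) = \<sigma>\<^sup>2"
      using normal_distributed_variance[OF 2] gaussian_field_expectation[OF \<xi>] by (simp add: var)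
    have "distributed M lborel (\<lambda>\<omega>. \<xi> \<theta> \<omega> / \<sigma>) std_normal_density"
      using normal_standard_normal_convert[OF 2(1), of "\<xi> \<theta>" 0] 2(2) by simp
    then have std: "distr M lborel (\<lambda>\<omega>. \<xi> \<theta> \<omega> / \<sigma>) = std_normal_distribution"
      by (simp add: distributed_def)
    have "(CLINT \<omega>|M. iexp (\<xi> \<theta> \<omega>)) = (CLINT \<omega>|M. iexp (\<sigma> * (\<xi> \<theta> \<omega> / \<sigma>)))"
      using 2(1) by simp
    also have "\<dots> = (CLINT x|distr M lborel (\<lambda>\<omega>. \<xi> \<theta> \<omega> / \<sigma>). iexp (\<sigma> * x))"
      by (rule integral_distr[symmetric]) auto
    also have "\<dots> = char std_normal_distribution \<sigma>"
      by (simp add: std char_def)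
    finally show ?thesis
      by (simp add: char_std_normal_distribution \<sigma>)
  qed
qed

lemma quadratic_form_sum_orthogonal:
  assumes "linear Q" "finite J"
    and "\<And>j k. j \<in> J \<Longrightarrow> k \<in> J \<Longrightarrow> j \<noteq> k \<Longrightarrow> blinfun_apply (\<zeta> j) (Q (\<zeta> k)) = 0"
  shows "blinfun_apply (\<Sum>j\<in>J. \<zeta> j) (Q (\<Sum>j\<in>J. \<zeta> j)) = (\<Sum>j\<in>J. blinfun_apply (\<zeta> j) (Q (\<zeta> j)))"
proof -
  have "blinfun_apply (\<Sum>j\<in>J. \<zeta> j) (Q (\<Sum>j\<in>J. \<zeta> j)) =
      (\<Sum>j\<in>J. \<Sum>k\<in>J. blinfun_apply (\<zeta> j) (Q (\<zeta> k)))"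
    by (subst sum.swap) (simp add: linear_sum[OF assms(1)] blinfun.sum_left blinfun.sum_right)
  also have "\<dots> = (\<Sum>j\<in>J. \<Sum>k\<in>J. if k = j then blinfun_apply (\<zeta> j) (Q (\<zeta> k)) else 0)"
    using assms(3) by (intro sum.cong) auto
  finally show ?thesis
    using assms(2) by simp
qed

text \<open>Linear combinations over all blocks collapse, by almost sure linearity, to one variable
  of the field, whose characteristic function is explicit. Orthogonality makes the quadratic form in
  the exponent additive over blocks. The \<open>Y j s\<close> are mere versions because conditional
  expectations are determined only up to null sets.\<close>

lemma (in prob_space) gaussian_field_orthogonal_imp_indep:
  fixes Y :: "'j \<Rightarrow> 's \<Rightarrow> 'a \<Rightarrow> real"
  assumes \<xi>: "gaussian_field M Q \<xi>"
    and Y: "\<And>j s. j \<in> K \<Longrightarrow> s \<in> S j \<Longrightarrow> Y j s \<in> borel_measurable M"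
    and Y_eq: "\<And>j s. j \<in> K \<Longrightarrow> s \<in> S j \<Longrightarrow> AE \<omega> in M. Y j s \<omega> = \<xi> (f j s) \<omega>"
    and orth: "\<And>j k s t. j \<in> K \<Longrightarrow> k \<in> K \<Longrightarrow> j \<noteq> k \<Longrightarrow> s \<in> S j \<Longrightarrow> t \<in> S k \<Longrightarrow>
        blinfun_apply (f j s) (Q (f k t)) = 0"
  shows "indep_vars (\<lambda>j. PiM (S j) (\<lambda>_. borel)) (\<lambda>j \<omega>. \<lambda>s\<in>S j. Y j s \<omega>) K"
proof (rule indep_vars_if_char_factorizes[OF Y])
  fix J T c
  assume J: "finite J" "J \<subseteq> K" and T: "\<And>j. j \<in> J \<Longrightarrow> finite (T j) \<and> T j \<subseteq> S j"
  note [measurable] = gaussian_fieldD(3)[OF \<xi>]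
  note lin = gaussian_fieldD(1)[OF \<xi>]
  define \<zeta> where "\<zeta> j = (\<Sum>s\<in>T j. c j s *\<^sub>R f j s)" for j
  have meas: "(\<lambda>\<omega>. \<Sum>s\<in>T j. c j s * Y j s \<omega>) \<in> borel_measurable M" if "j \<in> J" for j
    using Y T[OF that] J that by (intro borel_measurable_sum borel_measurable_times) auto
  have block: "AE \<omega> in M. (\<Sum>s\<in>T j. c j s * Y j s \<omega>) = \<xi> (\<zeta> j) \<omega>" if "j \<in> J" for j
  proof -
    have "AE \<omega> in M. \<forall>s\<in>T j. Y j s \<omega> = \<xi> (f j s) \<omega>"
      using T[OF that] J that by (intro AE_finite_allI Y_eq) auto
    moreover have "AE \<omega> in M. \<xi> (\<zeta> j) \<omega> = (\<Sum>s\<in>T j. c j s * \<xi> (f j s) \<omega>)"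
      unfolding \<zeta>_def using T[OF that] by (intro gaussian_field_sum[OF \<xi>]) auto
    ultimately show ?thesis
      by eventually_elim simp
  qed
  have orth_\<zeta>: "blinfun_apply (\<zeta> j) (Q (\<zeta> k)) = 0" if "j \<in> J" "k \<in> J" "j \<noteq> k" for j k
  proof -
    have "blinfun_apply (f j s) (Q (f k t)) = 0" if "s \<in> T j" "t \<in> T k" for s t
      using orth[of j k s t] T J that \<open>j \<in> J\<close> \<open>k \<in> J\<close> \<open>j \<noteq> k\<close> by blast
    then show ?thesis
      by (simp add: \<zeta>_def linear_sum[OF lin] linear_scale[OF lin] blinfun.sum_left blinfun.sum_right
          blinfun.scaleR_left blinfun.scaleR_right)
  qed
  have sum: "AE \<omega> in M. (\<Sum>j\<in>J. \<Sum>s\<in>T j. c j s * Y j s \<omega>) = \<xi> (\<Sum>j\<in>J. \<zeta> j) \<omega>"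
  proof -
    have "AE \<omega> in M. \<forall>j\<in>J. (\<Sum>s\<in>T j. c j s * Y j s \<omega>) = \<xi> (\<zeta> j) \<omega>"
      using J block by (intro AE_finite_allI)
    moreover have "AE \<omega> in M. \<xi> (\<Sum>j\<in>J. 1 *\<^sub>R \<zeta> j) \<omega> = (\<Sum>j\<in>J. 1 * \<xi> (\<zeta> j) \<omega>)"
      by (rule gaussian_field_sum[OF \<xi> J(1)])
    ultimately show ?thesis
      by eventually_elim simp
  qed
  have "(CLINT \<omega>|M. (\<Prod>j\<in>J. iexp (\<Sum>s\<in>T j. c j s * Y j s \<omega>))) =
      (CLINT \<omega>|M. iexp (\<Sum>j\<in>J. \<Sum>s\<in>T j. c j s * Y j s \<omega>))"
    using J(1) by (simp add: exp_sum sum_distrib_left)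
  also have "\<dots> = (CLINT \<omega>|M. iexp (\<xi> (\<Sum>j\<in>J. \<zeta> j) \<omega>))"
  proof (rule integral_cong_AE)
    have [measurable]: "(\<lambda>\<omega>. \<Sum>j\<in>J. \<Sum>s\<in>T j. c j s * Y j s \<omega>) \<in> borel_measurable M"
      by (rule borel_measurable_sum) (rule meas)
    show "(\<lambda>\<omega>. iexp (\<Sum>j\<in>J. \<Sum>s\<in>T j. c j s * Y j s \<omega>)) \<in> borel_measurable M"
      by measurable
    show "AE \<omega> in M. iexp (\<Sum>j\<in>J. \<Sum>s\<in>T j. c j s * Y j s \<omega>) = iexp (\<xi> (\<Sum>j\<in>J. \<zeta> j) \<omega>)"
      using sum by eventually_elim (simp del: of_real_sum)
  qed measurable
  also have "\<dots> = of_real (exp (\<Sum>j\<in>J. - blinfun_apply (\<zeta> j) (Q (\<zeta> j)) / 2))"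
    using quadratic_form_sum_orthogonal[OF lin J(1), of \<zeta>] orth_\<zeta>
    by (simp add: gaussian_field_char[OF \<xi>] sum_negf sum_divide_distrib)
  also have "\<dots> = (\<Prod>j\<in>J. CLINT \<omega>|M. iexp (\<xi> (\<zeta> j) \<omega>))"
    using J(1) by (simp add: gaussian_field_char[OF \<xi>] exp_sum)
  also have "\<dots> = (\<Prod>j\<in>J. CLINT \<omega>|M. iexp (\<Sum>s\<in>T j. c j s * Y j s \<omega>))"
  proof (intro prod.cong refl integral_cong_AE)
    fix j assume j: "j \<in> J"
    note [measurable] = meas[OF j]
    show "(\<lambda>\<omega>. iexp (\<Sum>s\<in>T j. c j s * Y j s \<omega>)) \<in> borel_measurable M"
      by measurable
    show "AE \<omega> in M. iexp (\<xi> (\<zeta> j) \<omega>) = iexp (\<Sum>s\<in>T j. c j s * Y j s \<omega>)"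
      using block[OF j] by eventually_elim (simp del: of_real_sum)
  qed measurable
  finally show "(CLINT \<omega>|M. (\<Prod>j\<in>J. iexp (\<Sum>s\<in>T j. c j s * Y j s \<omega>))) =
      (\<Prod>j\<in>J. CLINT \<omega>|M. iexp (\<Sum>s\<in>T j. c j s * Y j s \<omega>))" .
qed

section \<open>Orthogonal projections and gamblets\<close>

lemma independent_family_sum_zeroD:
  assumes "independent_family I f" "finite I" "(\<Sum>i\<in>I. c i *\<^sub>R f i) = 0" "i \<in> I"
  shows "c i = 0"
proof -
  have inj: "inj_on f I" and ind: "independent (f ` I)"
    using assms(1) by (auto simp: independent_family_def)
  have "(\<Sum>v\<in>f ` I. c (the_inv_into I f v) *\<^sub>R v) = (\<Sum>i\<in>I. c i *\<^sub>R f i)"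
    by (subst sum.reindex[OF inj]) (auto intro!: sum.cong simp: the_inv_into_f_f[OF inj])
  then have "c (the_inv_into I f (f i)) = 0"
    using assms independentD[OF ind, of "f ` I" "\<lambda>v. c (the_inv_into I f v)" "f i"] by simp
  then show ?thesis
    using assms(4) by (simp add: the_inv_into_f_f[OF inj])
qed

lemma independent_familyI:
  assumes "finite I" and zero: "\<And>c i. (\<Sum>i\<in>I. c i *\<^sub>R f i) = 0 \<Longrightarrow> i \<in> I \<Longrightarrow> c i = 0"
  shows "independent_family I f"
proof -
  have inj: "inj_on f I"
  proof (rule inj_onI, rule ccontr)
    fix i j assume ij: "i \<in> I" "j \<in> I" "f i = f j" "i \<noteq> j"
    \<comment> \<open>Coefficients \<open>1\<close> and \<open>-1\<close> at two indices with the
      same vector would be a nontrivial relation.\<close>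
    define c :: "'a \<Rightarrow> real" where "c k = (if k = i then 1 else if k = j then -1 else 0)" for k
    have "(\<Sum>k\<in>I. c k *\<^sub>R f k) = (\<Sum>k\<in>{i, j}. c k *\<^sub>R f k)"
      using ij assms(1) by (intro sum.mono_neutral_right) (auto simp: c_def)
    also have "\<dots> = 0"
      using ij by (simp add: c_def)
    finally show False
      using zero[of c i] ij by (simp add: c_def)
  qed
  have "independent (f ` I)"
  proof (rule independent_if_scalars_zero)
    fix c v assume c: "(\<Sum>x\<in>f ` I. c x *\<^sub>R x) = 0" and v: "v \<in> f ` I"
    then have "(\<Sum>i\<in>I. c (f i) *\<^sub>R f i) = 0"
      by (simp add: sum.reindex[OF inj])
    then show "c v = 0"
      using zero[of "\<lambda>i. c (f i)"] v by auto
  qed (use assms in simp)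
  with inj show ?thesis
    by (simp add: independent_family_def)
qed

text \<open>A basis chosen among the rows has as many elements as the rank, here
  \<open>card I\<close>. Hence the rows are pairwise distinct and all belong to the basis.\<close>

lemma full_rank_rows_independent:
  fixes A :: "'a \<Rightarrow> 'c \<Rightarrow> real"
  assumes I: "finite I" and rank: "matrix_rank I J A = card I"
    and zero: "\<And>j. j \<in> J \<Longrightarrow> (\<Sum>i\<in>I. c i * A i j) = 0" and i: "i \<in> I"
  shows "c i = 0"
proof -
  interpret rows: vector_space "\<lambda>(c::real) (f :: 'c \<Rightarrow> real) j. c * f j"
    by unfold_locales (auto simp: fun_eq_iff algebra_simps)
  define r where "r i j = (if j \<in> J then A i j else 0)" for i j
  obtain B where B: "B \<subseteq> r ` I" "rows.independent B" "card B = rows.dim (r ` I)"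
    using rows.basis_exists by metis
  have "card B = card I"
    using B(3) rank by (simp add: matrix_rank_def r_def[abs_def])
  then have BI: "B = r ` I" "card (r ` I) = card I"
    using B(1) card_image_le[OF I, of r] card_mono[OF _ B(1)] card_subset_eq[OF _ B(1)] I
    by (simp_all add: le_antisym)
  then have inj: "inj_on r I"
    using I by (intro eq_card_imp_inj_on)
  let ?d = "\<lambda>v. c (the_inv_into I r v)"
  have "(\<Sum>v\<in>r ` I. (\<lambda>j. ?d v * v j)) = (\<Sum>i\<in>I. (\<lambda>j. c i * r i j))"
    by (subst sum.reindex[OF inj]) (auto intro!: sum.cong simp: the_inv_into_f_f[OF inj])
  also have "\<dots> = 0"
  proof
    fix j
    have "(\<Sum>i\<in>I. (\<lambda>j. c i * r i j)) j = (\<Sum>i\<in>I. c i * r i j)"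
      using I by induction auto
    then show "(\<Sum>i\<in>I. (\<lambda>j. c i * r i j)) j = 0 j"
      using zero by (cases "j \<in> J") (auto simp: r_def)
  qed
  finally have "?d (r i) = 0"
    using rows.independentD[of "r ` I" "r ` I" ?d "r i"] B(2) BI I i by simp
  then show ?thesis
    using i by (simp add: the_inv_into_f_f[OF inj])
qed

text \<open>A relation among the \<open>g i\<close> expands to one among the \<open>f j\<close>,
  whose coefficients must vanish. So \<open>c\<close> combines the rows of \<open>A\<close> to zero,
  and full row rank forces \<open>c\<close> to vanish on \<open>I\<close>.\<close>

lemma nested_independent_family:
  assumes "finite I" "finite J" and f: "independent_family J f"
    and rank: "matrix_rank I J A = card I"
    and g: "\<And>i. i \<in> I \<Longrightarrow> g i = (\<Sum>j\<in>J. A i j *\<^sub>R f j)"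
  shows "independent_family I g"
proof (rule independent_familyI[OF \<open>finite I\<close>])
  fix c i assume c: "(\<Sum>i\<in>I. c i *\<^sub>R g i) = 0" and i: "i \<in> I"
  have "(\<Sum>i\<in>I. c i *\<^sub>R g i) = (\<Sum>i\<in>I. \<Sum>j\<in>J. (c i * A i j) *\<^sub>R f j)"
    by (simp add: g scaleR_sum_right)
  also have "\<dots> = (\<Sum>j\<in>J. (\<Sum>i\<in>I. c i * A i j) *\<^sub>R f j)"
    by (subst sum.swap) (simp add: scaleR_sum_left)
  finally have "(\<Sum>j\<in>J. (\<Sum>i\<in>I. c i * A i j) *\<^sub>R f j) = 0"
    using c by simp
  then have "(\<Sum>i\<in>I. c i * A i j) = 0" if "j \<in> J" for j
    using that by (rule independent_family_sum_zeroD[OF f assms(2)])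
  then show "c i = 0"
    using full_rank_rows_independent[OF assms(1) rank] i by blast
qed

text \<open>\<open>ARG_MIN\<close> is a choice operator: \<open>u\<close> shows that a minimizer
  exists, and strict minimality that no other one can be chosen.\<close>

lemma gamblet_eqI:
  fixes f :: "'a \<Rightarrow> 'b::real_normed_vector dual"
  assumes "\<And>j. j \<in> I \<Longrightarrow> blinfun_apply (f j) u = (if i = j then 1 else 0)"
    and "\<And>v. (\<And>j. j \<in> I \<Longrightarrow> blinfun_apply (f j) v = (if i = j then 1 else 0)) \<Longrightarrow> v \<noteq> u \<Longrightarrow> norm u < norm v"
  shows "gamblet I f i = u"
proof -
  let ?P = "\<lambda>v. \<forall>j\<in>I. blinfun_apply (f j) v = (if i = j then 1 else 0)"
  have "is_arg_min norm ?P u"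
    using assms by (force simp: is_arg_min_def)
  then have "is_arg_min norm ?P (gamblet I f i)"
    unfolding gamblet_def arg_min_def by (rule someI)
  then show ?thesis
    using assms by (force simp: is_arg_min_def)
qed

text \<open>These properties make \<open>[\<theta>, Q \<zeta>]\<close> an inner product on the dual,
  in which the geometry below takes place.\<close>

locale covariance_operator =
  fixes Q :: "'b::real_normed_vector dual \<Rightarrow> 'b"
  assumes linear_Q: "linear Q" and symmetric_Q: "symmetric_op Q" and positive_Q: "positive_op Q"
begin

text \<open>The choice is harmless for finite \<open>S\<close>: existence is
  \<open>orth_proj_exists\<close> and uniqueness is \<open>orth_proj_eqI\<close>.\<close>

definition orth_proj :: "'b dual set \<Rightarrow> 'b dual \<Rightarrow> 'b dual" where
  "orth_proj S \<theta> = (SOME p. p \<in> span S \<and> (\<forall>s\<in>S. blinfun_apply s (Q (\<theta> - p)) = 0))"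

lemmas Q_simps = linear_add[OF linear_Q] linear_diff[OF linear_Q] linear_scale[OF linear_Q]
  linear_0[OF linear_Q] linear_sum[OF linear_Q]

lemmas form_simps = Q_simps blinfun.add_left blinfun.add_right blinfun.diff_left blinfun.diff_right
  blinfun.scaleR_left blinfun.scaleR_right blinfun.zero_left blinfun.zero_right
  blinfun.sum_left blinfun.sum_right

lemma form_commute: "blinfun_apply \<theta> (Q \<zeta>) = blinfun_apply \<zeta> (Q \<theta>)"
  using symmetric_Q unfolding symmetric_op_def by blast

lemma form_eq_zero_iff: "blinfun_apply \<theta> (Q \<theta>) = 0 \<longleftrightarrow> \<theta> = 0"
  using positive_Q unfolding positive_op_def by (auto simp: form_simps)

section \<open>Orthogonal projection onto the span of finitely many functionals\<close>

lemma orth_span: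
  assumes "\<And>s. s \<in> S \<Longrightarrow> blinfun_apply s u = 0" "\<zeta> \<in> span S"
  shows "blinfun_apply \<zeta> u = 0"
  using assms(2)
  by (rule span_induct) (auto simp: subspace_def form_simps assms(1))

text \<open>A Gram-Schmidt step: \<open>d\<close> is the part of the new vector orthogonal to the
  old span, and a multiple of it corrects the old projection. The induction hypothesis serves both
  \<open>\<theta>\<close> and \<open>a\<close>.\<close>

lemma orth_proj_exists:
  assumes "finite S"
  shows "\<exists>p. p \<in> span S \<and> (\<forall>s\<in>S. blinfun_apply s (Q (\<theta> - p)) = 0)"
  using assms
proof (induction S arbitrary: \<theta>)
  case empty
  show ?case by (auto intro: exI[of _ 0])
next
  case (insert a S)
  obtain p where p: "p \<in> span S" "\<And>s. s \<in> S \<Longrightarrow> blinfun_apply s (Q (\<theta> - p)) = 0"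
    using insert.IH by blast
  obtain a' where a': "a' \<in> span S" "\<And>s. s \<in> S \<Longrightarrow> blinfun_apply s (Q (a - a')) = 0"
    using insert.IH by blast
  define d where "d = a - a'"
  \<comment> \<open>The usual projection coefficient along \<open>d\<close>. If \<open>a\<close>
    already lies in the old span, then \<open>d = 0\<close> and the correction
    \<open>t *\<^sub>R d\<close> vanishes whatever \<open>t\<close> is.\<close>
  define t where "t = blinfun_apply d (Q \<theta>) / blinfun_apply d (Q d)"
  have mono: "x \<in> span (insert a S)" if "x \<in> span S" for x
    using that span_mono[of S "insert a S"] by blast
  have d_orth: "blinfun_apply x (Q d) = 0" if "x \<in> span S" for x
    using orth_span[OF a'(2) that] by (simp add: d_def)
  have "blinfun_apply d (Q (\<theta> - (p + t *\<^sub>R d))) = 0"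
  proof (cases "d = 0")
    case True
    then show ?thesis by (simp add: form_simps)
  next
    case False
    then show ?thesis
      using d_orth[OF p(1)] form_eq_zero_iff[of d] form_commute[of d p]
      by (simp add: form_simps t_def)
  qed
  moreover have S: "blinfun_apply x (Q (\<theta> - (p + t *\<^sub>R d))) = 0" if "x \<in> span S" for x
    using orth_span[OF p(2) that] d_orth[OF that] by (simp add: form_simps)
  moreover have "blinfun_apply a v = blinfun_apply d v + blinfun_apply a' v" for v
    by (simp add: d_def form_simps)
  moreover have "p + t *\<^sub>R d \<in> span (insert a S)"
    unfolding d_def
    by (intro span_add span_scale span_diff mono[OF p(1)] mono[OF a'(1)]) (simp add: span_base)
  ultimately show ?case
    using a'(1) by (intro exI[of _ "p + t *\<^sub>R d"]) (auto intro: span_base)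
qed

lemma
  assumes "finite S"
  shows orth_proj_in_span: "orth_proj S \<theta> \<in> span S"
    and orth_proj_orth: "\<zeta> \<in> span S \<Longrightarrow> blinfun_apply \<zeta> (Q (\<theta> - orth_proj S \<theta>)) = 0"
proof -
  have *: "orth_proj S \<theta> \<in> span S \<and> (\<forall>s\<in>S. blinfun_apply s (Q (\<theta> - orth_proj S \<theta>)) = 0)"
    unfolding orth_proj_def by (rule someI_ex[OF orth_proj_exists[OF assms]])
  then show "orth_proj S \<theta> \<in> span S"
    by blast
  show "\<zeta> \<in> span S \<Longrightarrow> blinfun_apply \<zeta> (Q (\<theta> - orth_proj S \<theta>)) = 0"
    using * by (blast intro: orth_span)
qed

text \<open>The difference of two candidates lies in the span and is orthogonal to it, hence to
  itself, so positivity makes it zero.\<close>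

lemma orth_proj_eqI:
  assumes "finite S" "p \<in> span S" "\<And>\<zeta>. \<zeta> \<in> span S \<Longrightarrow> blinfun_apply \<zeta> (Q (\<theta> - p)) = 0"
  shows "orth_proj S \<theta> = p"
proof -
  let ?d = "orth_proj S \<theta> - p"
  have "?d \<in> span S"
    using assms orth_proj_in_span by (intro span_diff)
  then have "blinfun_apply ?d (Q ((\<theta> - p) - (\<theta> - orth_proj S \<theta>))) = 0"
    unfolding Q_simps(2)[of "\<theta> - p"] using assms orth_proj_orth[OF assms(1)]
    by (simp add: blinfun.diff_right)
  then have "blinfun_apply ?d (Q ?d) = 0"
    by simp
  then show ?thesis
    by (simp only: form_eq_zero_iff right_minus_eq)
qed

text \<open>Sums and multiples of projections satisfy the conditions that characterize the
  projection uniquely.\<close>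

lemma linear_orth_proj:
  assumes "finite S"
  shows "linear (orth_proj S)"
proof (rule linearI)
  fix \<theta> \<zeta> and c :: real
  have o: "blinfun_apply x (Q \<theta>) = blinfun_apply x (Q (orth_proj S \<theta>))" if "x \<in> span S" for x \<theta>
    using orth_proj_orth[OF assms that, of \<theta>] by (simp add: form_simps)
  show "orth_proj S (\<theta> + \<zeta>) = orth_proj S \<theta> + orth_proj S \<zeta>"
    by (rule orth_proj_eqI[OF assms])
      (simp_all add: span_add orth_proj_in_span assms form_simps o[of _ \<theta>] o[of _ \<zeta>])
  show "orth_proj S (c *\<^sub>R \<theta>) = c *\<^sub>R orth_proj S \<theta>"
    by (rule orth_proj_eqI[OF assms])
      (simp_all add: span_scale orth_proj_in_span assms form_simps o[of _ \<theta>])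
qed

text \<open>Both residuals are orthogonal to the smaller span, hence so is their difference. This is
  the source of the independent increments.\<close>

lemma orth_proj_diff_orth:
  assumes "finite S" "finite S'" "S \<subseteq> span S'" "\<zeta> \<in> span S"
  shows "blinfun_apply \<zeta> (Q (orth_proj S' \<theta> - orth_proj S \<theta>)) = 0"
proof -
  have "\<zeta> \<in> span S'"
    using assms(3,4) span_mono[of S "span S'"] by (auto simp: span_span)
  then show ?thesis
    using orth_proj_orth[OF assms(1,4), of \<theta>] orth_proj_orth[OF assms(2), of \<zeta> \<theta>]
    by (simp add: form_simps)
qed

text \<open>The difference of nested projections behaves as a self-adjoint projection for the form.
  This identity later makes \<open>Q\<close> composed with that difference a covariance
  operator.\<close>

lemma orth_proj_diff_idem:
  assumes "finite S" "finite S'" "S \<subseteq> span S'"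
  shows "blinfun_apply (orth_proj S' \<theta> - orth_proj S \<theta>) (Q (orth_proj S' \<zeta> - orth_proj S \<zeta>)) =
    blinfun_apply \<theta> (Q (orth_proj S' \<zeta> - orth_proj S \<zeta>))"
proof -
  let ?D = "orth_proj S' \<zeta> - orth_proj S \<zeta>"
  have "orth_proj S \<zeta> \<in> span S'"
    using orth_proj_in_span[OF assms(1)] span_mono[OF assms(3)] by (auto simp: span_span)
  then have "?D \<in> span S'"
    by (intro span_diff orth_proj_in_span assms)
  then have "blinfun_apply (\<theta> - orth_proj S' \<theta>) (Q ?D) = 0"
    using orth_proj_orth[OF assms(2)] form_commute[of _ ?D] by simp
  moreover have "blinfun_apply (orth_proj S \<theta>) (Q ?D) = 0"
    by (intro orth_proj_diff_orth orth_proj_in_span assms)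
  ultimately show ?thesis
    by (simp add: blinfun.diff_left)
qed

section \<open>The dual basis and the gamblets\<close>

lemma dual_basis_exists:
  assumes I: "finite I" and f: "independent_family I f" and i: "i \<in> I"
  obtains \<zeta> where "\<zeta> \<in> span (f ` I)" "\<And>j. j \<in> I \<Longrightarrow> blinfun_apply (f j) (Q \<zeta>) = (if i = j then 1 else 0)"
proof -
  let ?S = "f ` (I - {i})"
  define p where "p = orth_proj ?S (f i)"
  \<comment> \<open>Scaling the component of \<open>f i\<close> orthogonal to the other vectors gives the dual vector.\<close>
  define d where "d = f i - p"
  have S: "finite ?S" using I by simp
  have p: "p \<in> span ?S"
    unfolding p_def using S by (rule orth_proj_in_span)
  have d_orth: "blinfun_apply x (Q d) = 0" if "x \<in> span ?S" for x
    unfolding d_def p_def using S that by (rule orth_proj_orth)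
  have "?S = f ` I - {f i}"
    using f i by (auto simp: independent_family_def inj_on_def)
  \<comment> \<open>Independence keeps \<open>f i\<close> out of the span of the others, so
    \<open>d\<close> is nonzero and the scaling is possible.\<close>
  then have "f i \<notin> span ?S"
    using f i by (auto simp: independent_family_def dependent_def)
  with p have "d \<noteq> 0"
    by (auto simp: d_def)
  then have nz: "blinfun_apply d (Q d) \<noteq> 0"
    by (simp add: form_eq_zero_iff)
  have fi: "blinfun_apply (f i) (Q d) = blinfun_apply d (Q d)"
    using d_orth[OF p] by (simp add: d_def blinfun.diff_left)
  show thesis
  proof (rule that)
    show "(1 / blinfun_apply d (Q d)) *\<^sub>R d \<in> span (f ` I)"
      unfolding d_def using p i span_mono[of ?S "f ` I"]
      by (intro span_scale span_diff) (auto intro: span_base)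
    show "blinfun_apply (f j) (Q ((1 / blinfun_apply d (Q d)) *\<^sub>R d)) = (if i = j then 1 else 0)"
      if "j \<in> I" for j
      using that nz fi d_orth[of "f j"] by (auto simp: form_simps intro: span_base)
  qed
qed

text \<open>A competitor has the form \<open>Q (\<zeta> + \<theta>)\<close>, and equal measurements
  make \<open>\<theta>\<close> orthogonal to every \<open>f j\<close>, hence to
  \<open>\<zeta>\<close>. By Pythagoras its squared norm exceeds that of \<open>Q \<zeta>\<close> by
  \<open>[\<theta>, Q \<theta>]\<close>, which is positive unless
  \<open>\<theta> = 0\<close>.\<close>

lemma gamblet_eq_dual_basis:
  assumes bij: "bij Q" and norm: "\<And>u. (norm u)\<^sup>2 = blinfun_apply (inv Q u) u"
    and \<zeta>: "\<zeta> \<in> span (f ` I)" "\<And>j. j \<in> I \<Longrightarrow> blinfun_apply (f j) (Q \<zeta>) = (if i = j then 1 else 0)"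
  shows "gamblet I f i = Q \<zeta>"
proof (rule gamblet_eqI[OF \<zeta>(2)])
  fix v
  assume v: "\<And>j. j \<in> I \<Longrightarrow> blinfun_apply (f j) v = (if i = j then 1 else 0)" "v \<noteq> Q \<zeta>"
  obtain \<theta> where \<theta>: "v = Q (\<zeta> + \<theta>)"
    using bij_is_surj[OF bij] by (metis add.commute diff_add_cancel surjD)
  have norm_Q: "(norm (Q \<theta>))\<^sup>2 = blinfun_apply \<theta> (Q \<theta>)" for \<theta>
    using norm[of "Q \<theta>"] bij by (simp add: bij_is_inj)
  have "\<theta> \<noteq> 0"
    using v(2) \<theta> by auto
  then have "blinfun_apply \<theta> (Q \<theta>) > 0"
    using positive_Q by (simp add: positive_op_def)
  moreover have "blinfun_apply \<zeta> (Q \<theta>) = 0"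
    using \<zeta>(2) v(1) by (intro orth_span[OF _ \<zeta>(1)]) (auto simp: \<theta> form_simps)
  then have "blinfun_apply (\<zeta> + \<theta>) (Q (\<zeta> + \<theta>)) = blinfun_apply \<zeta> (Q \<zeta>) + blinfun_apply \<theta> (Q \<theta>)"
    using form_commute[of \<theta> \<zeta>] by (simp add: form_simps)
  ultimately have "(norm (Q \<zeta>))\<^sup>2 < (norm v)\<^sup>2"
    by (simp add: \<theta> norm_Q)
  then show "norm (Q \<zeta>) < norm v"
    by (rule power_less_imp_less_base) simp
qed

text \<open>Pairing the projection with a dual vector reads off one coefficient; as the dual vector
  lies in the span, \<open>\<theta>\<close> may replace its projection there.\<close>

lemma orth_proj_eq_gamblet_sum:
  assumes bij: "bij Q" and norm: "\<And>u. (norm u)\<^sup>2 = blinfun_apply (inv Q u) u"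
    and I: "finite I" and f: "independent_family I f"
  shows "orth_proj (f ` I) \<theta> = (\<Sum>i\<in>I. blinfun_apply \<theta> (gamblet I f i) *\<^sub>R f i)"
proof -
  have fin: "finite (f ` I)" using I by simp
  have "orth_proj (f ` I) \<theta> \<in> span (f ` I)"
    using fin by (rule orth_proj_in_span)
  then obtain u where u: "orth_proj (f ` I) \<theta> = (\<Sum>v\<in>f ` I. u v *\<^sub>R v)"
    unfolding span_finite[OF fin] by blast
  have inj: "inj_on f I"
    using f by (simp add: independent_family_def)
  have p: "orth_proj (f ` I) \<theta> = (\<Sum>i\<in>I. u (f i) *\<^sub>R f i)"
    unfolding u by (simp add: sum.reindex[OF inj])
  have "blinfun_apply \<theta> (gamblet I f i) = u (f i)" if i: "i \<in> I" for i
  proof -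
    obtain \<zeta> where \<zeta>: "\<zeta> \<in> span (f ` I)"
        "\<And>j. j \<in> I \<Longrightarrow> blinfun_apply (f j) (Q \<zeta>) = (if i = j then 1 else 0)"
      using dual_basis_exists[OF I f i] by blast
    have "blinfun_apply \<theta> (gamblet I f i) = blinfun_apply \<zeta> (Q \<theta>)"
      using gamblet_eq_dual_basis[OF bij norm \<zeta>] form_commute by simp
    also have "\<dots> = blinfun_apply \<zeta> (Q (orth_proj (f ` I) \<theta>))"
      using orth_proj_orth[OF fin \<zeta>(1), of \<theta>] by (simp add: form_simps)
    also have "\<dots> = (\<Sum>j\<in>I. u (f j) * blinfun_apply (f j) (Q \<zeta>))"
      unfolding p by (simp add: form_simps form_commute[of \<zeta>])
    also have "\<dots> = (\<Sum>j\<in>I. if i = j then u (f j) else 0)"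
      using \<zeta>(2) by (intro sum.cong) auto
    finally show ?thesis
      using I i by simp
  qed
  then show ?thesis
    unfolding p by simp
qed

end

section \<open>Conditioning on observations\<close>

lemma (in prob_space)
  assumes "\<And>i. i \<in> I \<Longrightarrow> \<xi> (f i) \<in> borel_measurable M"
  shows space_observation_algebra: "space (observation_algebra M \<xi> I f) = space M"
    and sets_observation_algebra: "sets (observation_algebra M \<xi> I f) =
      sigma_sets (space M) ({\<xi> (f i) -` A \<inter> space M |i A. i \<in> I \<and> A \<in> sets borel} \<union> null_sets M)"
    and subalgebra_observation_algebra: "subalgebra M (observation_algebra M \<xi> I f)"
proof -
  let ?G = "{\<xi> (f i) -` A \<inter> space M |i A. i \<in> I \<and> A \<in> sets borel} \<union> null_sets M"
  have G: "?G \<subseteq> events"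
    using assms by (auto intro: measurable_sets)
  then have "?G \<subseteq> Pow (space M)"
    using sets.space_closed by blast
  then show *: "space (observation_algebra M \<xi> I f) = space M"
    "sets (observation_algebra M \<xi> I f) = sigma_sets (space M) ?G"
    by (simp_all add: observation_algebra_def)
  show "subalgebra M (observation_algebra M \<xi> I f)"
    unfolding subalgebra_def * using sets.sigma_sets_subset[OF G] by simp
qed

context prob_space
begin

context
  fixes \<xi> :: "('b::real_normed_vector, 'a) field" and I :: "'i set" and f :: "'i \<Rightarrow> 'b dual"
  assumes meas: "\<And>\<theta>. \<xi> \<theta> \<in> borel_measurable M"
begin

lemma observation_measurable:
  assumes "i \<in> I"
  shows "\<xi> (f i) \<in> borel_measurable (observation_algebra M \<xi> I f)"
proof (rule measurableI)
  fix A :: "real set" assume "A \<in> sets borel"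
  then show "\<xi> (f i) -` A \<inter> space (observation_algebra M \<xi> I f) \<in> sets (observation_algebra M \<xi> I f)"
    unfolding space_observation_algebra[of I \<xi> f, OF meas] sets_observation_algebra[of I \<xi> f, OF meas]
    using assms by (intro sigma_sets.Basic UnI1 CollectI exI conjI) auto
qed simp

lemma null_sets_subset_observation_algebra: "null_sets M \<subseteq> sets (observation_algebra M \<xi> I f)"
  by (auto intro!: sigma_sets.Basic simp: meas sets_observation_algebra)

text \<open>The purpose of the adjoined null events: a version stays measurable because its
  preimages change by null sets only.\<close>

lemma observation_algebra_measurable_AE:
  fixes X Y :: "'a \<Rightarrow> real"
  assumes Y: "Y \<in> borel_measurable (observation_algebra M \<xi> I f)"
    and [measurable]: "X \<in> borel_measurable M" and eq: "AE \<omega> in M. X \<omega> = Y \<omega>"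
  shows "X \<in> borel_measurable (observation_algebra M \<xi> I f)"
proof (rule measurableI)
  let ?F = "observation_algebra M \<xi> I f"
  note space = space_observation_algebra[of I \<xi> f, OF meas]
  have [measurable]: "Y \<in> borel_measurable M"
    using measurable_from_subalg[OF subalgebra_observation_algebra[OF meas] Y] .
  fix A :: "real set" assume [measurable]: "A \<in> sets borel"
  have YA: "Y -` A \<inter> space M \<in> sets ?F"
    using measurable_sets[OF Y \<open>A \<in> sets borel\<close>] by (simp add: space)
  let ?N1 = "{\<omega>\<in>space M. X \<omega> \<in> A \<and> Y \<omega> \<notin> A}" and ?N2 = "{\<omega>\<in>space M. X \<omega> \<notin> A \<and> Y \<omega> \<in> A}"
  have "?N1 \<in> null_sets M" "?N2 \<in> null_sets M"
    using eq by (auto intro!: AE_iff_null_sets[THEN iffD2] elim: eventually_mono)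
  then have N: "?N1 \<in> sets ?F" "?N2 \<in> sets ?F"
    using null_sets_subset_observation_algebra by auto
  have "X -` A \<inter> space ?F = ((Y -` A \<inter> space M) \<union> ?N1) - ?N2"
    by (auto simp: space)
  with YA N show "X -` A \<inter> space ?F \<in> sets ?F"
    by (simp add: sets.Un sets.Diff)
qed simp

text \<open>Induction over the generated \<sigma>-algebra. The almost sure form absorbs the adjoined
  null events, which the empty set represents. Coordinates are functionals rather than labels, so
  that the vector is a restriction of the whole field.\<close>

lemma observation_algebra_cylinder:
  assumes "A \<in> sets (observation_algebra M \<xi> I f)"
  shows "\<exists>C\<in>sets (PiM (f ` I) (\<lambda>_. borel)). AE \<omega> in M. \<omega> \<in> A \<longleftrightarrow> (\<lambda>\<theta>\<in>f ` I. \<xi> \<theta> \<omega>) \<in> C"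
  using assms unfolding sets_observation_algebra[of I \<xi> f, OF meas]
proof induction
  case (Basic A)
  then consider "A \<in> null_sets M"
    | i B where "i \<in> I" "B \<in> sets borel" "A = \<xi> (f i) -` B \<inter> space M"
    by auto
  then show ?case
  proof cases
    case 1
    then have "AE \<omega> in M. \<omega> \<notin> A"
      by (rule AE_not_in)
    then show ?thesis
      by (intro bexI[of _ "{}"]) auto
  next
    case 2
    have "(\<lambda>g. g (f i)) -` B \<inter> space (PiM (f ` I) (\<lambda>_. borel)) \<in> sets (PiM (f ` I) (\<lambda>_. borel))"
      using 2 by (intro measurable_sets[OF measurable_component_singleton]) auto
    moreover have "AE \<omega> in M. \<omega> \<in> A \<longleftrightarrow>
        (\<lambda>\<theta>\<in>f ` I. \<xi> \<theta> \<omega>) \<in> (\<lambda>g. g (f i)) -` B \<inter> space (PiM (f ` I) (\<lambda>_. borel))"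
      using 2 by (intro AE_I2) (auto simp: space_PiM)
    ultimately show ?thesis by blast
  qed
next
  case Empty
  then show ?case by (intro bexI[of _ "{}"]) auto
next
  case (Compl A)
  then obtain C where C: "C \<in> sets (PiM (f ` I) (\<lambda>_. borel))"
      "AE \<omega> in M. \<omega> \<in> A \<longleftrightarrow> (\<lambda>\<theta>\<in>f ` I. \<xi> \<theta> \<omega>) \<in> C"
    by blast
  have "AE \<omega> in M. \<omega> \<in> space M - A \<longleftrightarrow>
      (\<lambda>\<theta>\<in>f ` I. \<xi> \<theta> \<omega>) \<in> space (PiM (f ` I) (\<lambda>_. borel)) - C"
    using C(2) AE_space by eventually_elim (auto simp: space_PiM)
  then show ?case
    using C(1) by (intro bexI[of _ "space (PiM (f ` I) (\<lambda>_. borel)) - C"] sets.compl_sets)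
next
  case (Union A)
  have "\<forall>n\<in>UNIV. \<exists>C. C \<in> sets (PiM (f ` I) (\<lambda>_. borel)) \<and>
      (AE \<omega> in M. \<omega> \<in> A n \<longleftrightarrow> (\<lambda>\<theta>\<in>f ` I. \<xi> \<theta> \<omega>) \<in> C)"
    using Union.IH unfolding Bex_def by (intro ballI)
  then obtain C where "\<forall>n\<in>UNIV. C n \<in> sets (PiM (f ` I) (\<lambda>_. borel)) \<and>
      (AE \<omega> in M. \<omega> \<in> A n \<longleftrightarrow> (\<lambda>\<theta>\<in>f ` I. \<xi> \<theta> \<omega>) \<in> C n)"
    by (rule bchoice[THEN exE])
  then have C: "C n \<in> sets (PiM (f ` I) (\<lambda>_. borel))"
      "AE \<omega> in M. \<omega> \<in> A n \<longleftrightarrow> (\<lambda>\<theta>\<in>f ` I. \<xi> \<theta> \<omega>) \<in> C n" for n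
    by simp_all
  \<comment> \<open>Countably many exceptional null sets merge into one.\<close>
  have "AE \<omega> in M. \<forall>n. \<omega> \<in> A n \<longleftrightarrow> (\<lambda>\<theta>\<in>f ` I. \<xi> \<theta> \<omega>) \<in> C n"
    using C(2) by (simp add: AE_all_countable)
  then have "AE \<omega> in M. \<omega> \<in> (\<Union>n. A n) \<longleftrightarrow> (\<lambda>\<theta>\<in>f ` I. \<xi> \<theta> \<omega>) \<in> (\<Union>n. C n)"
    by eventually_elim auto
  then show ?case
    using C(1) by (intro bexI[of _ "\<Union>n. C n"] sets.countable_UN) (assumption, blast)
qed

end

text \<open>Orthogonality makes \<open>\<xi> \<zeta>\<close> independent of the vector of
  observations, so the integral factors, and one factor is the mean of a centered variable.\<close>

lemma integral_orthogonal_observation_eq_zero: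
  assumes \<xi>: "gaussian_field M Q \<xi>"
    and orth: "\<And>i. i \<in> I \<Longrightarrow> blinfun_apply (f i) (Q \<zeta>) = 0"
    and A: "A \<in> sets (observation_algebra M \<xi> I f)"
  shows "(LINT \<omega>|M. indicator A \<omega> * \<xi> \<zeta> \<omega>) = 0"
proof -
  note meas[measurable] = gaussian_fieldD(3)[OF \<xi>]
  have sym: "blinfun_apply \<theta> (Q \<theta>') = blinfun_apply \<theta>' (Q \<theta>)" for \<theta> \<theta>'
    using gaussian_fieldD(2)[OF \<xi>] by (simp add: symmetric_op_def)
  obtain C where C: "C \<in> sets (PiM (f ` I) (\<lambda>_. borel))"
      "AE \<omega> in M. \<omega> \<in> A \<longleftrightarrow> (\<lambda>\<theta>\<in>f ` I. \<xi> \<theta> \<omega>) \<in> C"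
    using observation_algebra_cylinder[OF meas A] by blast
  have [measurable]: "A \<in> events"
    using subalgebra_observation_algebra[of I \<xi> f, OF meas] A by (auto simp: subalgebra_def)
  let ?X = "\<lambda>\<omega>. \<lambda>\<theta>\<in>f ` I. \<xi> \<theta> \<omega>" and ?Z = "\<lambda>\<omega>. \<lambda>\<theta>\<in>{\<zeta>}. \<xi> \<theta> \<omega>"
  \<comment> \<open>Two blocks, the observed functionals and \<open>\<zeta>\<close> alone; the
    boolean index matches the definition of \<open>indep_var\<close>.\<close>
  let ?S = "\<lambda>b. if b then f ` I else {\<zeta>}"
  have "indep_vars (\<lambda>b. PiM (?S b) (\<lambda>_. borel)) (\<lambda>b \<omega>. \<lambda>\<theta>\<in>?S b. \<xi> \<theta> \<omega>) UNIV"
    by (rule gaussian_field_orthogonal_imp_indep[OF \<xi>, where f = "\<lambda>b \<theta>. \<theta>"])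
      (use orth sym[of \<zeta>] in \<open>auto split: if_splits\<close>)
  moreover have "(\<lambda>b. PiM (?S b) (\<lambda>_. borel)) =
      case_bool (PiM (f ` I) (\<lambda>_. borel)) (PiM {\<zeta>} (\<lambda>_. borel :: real measure))"
    by (auto split: bool.split)
  moreover have "(\<lambda>b \<omega>. \<lambda>\<theta>\<in>?S b. \<xi> \<theta> \<omega>) = case_bool ?X ?Z"
    by (auto split: bool.split)
  ultimately have "indep_var (PiM (f ` I) (\<lambda>_. borel)) ?X (PiM {\<zeta>} (\<lambda>_. borel)) ?Z"
    by (simp add: indep_var_def)
  then have "indep_var borel ((indicator C :: _ \<Rightarrow> real) \<circ> ?X) borel ((\<lambda>z. z \<zeta>) \<circ> ?Z)"
    by (rule indep_var_compose) (use C(1) in \<open>auto intro: measurable_component_singleton\<close>)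
  then have indep: "indep_var borel (\<lambda>\<omega>. indicator C (?X \<omega>) :: real) borel (\<xi> \<zeta>)"
    by (simp add: comp_def)
  have [measurable]: "(\<lambda>\<omega>. indicator C (?X \<omega>) :: real) \<in> borel_measurable M"
    using indep by (rule indep_var_rv1)
  have "(LINT \<omega>|M. indicator A \<omega> * \<xi> \<zeta> \<omega>) = (LINT \<omega>|M. indicator C (?X \<omega>) * \<xi> \<zeta> \<omega>)"
  proof (rule integral_cong_AE)
    show "AE \<omega> in M. indicator A \<omega> * \<xi> \<zeta> \<omega> = indicator C (?X \<omega>) * \<xi> \<zeta> \<omega>"
      using C(2) by eventually_elim (simp add: indicator_def)
  qed measurable
  also have "\<dots> = (LINT \<omega>|M. indicator C (?X \<omega>)) * (LINT \<omega>|M. \<xi> \<zeta> \<omega>)"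
    using indep by (rule indep_var_lebesgue_integral)
      (auto intro: integrable_const_bound[of _ 1] gaussian_fieldD(8)[OF \<xi>])
  finally show ?thesis
    by (simp add: gaussian_field_expectation[OF \<xi>])
qed

text \<open>\<open>\<xi> p\<close> agrees with the combination of observations only almost surely,
  which suffices thanks to the adjoined null events.\<close>

lemma gaussian_field_combination_measurable:
  assumes \<xi>: "gaussian_field M Q \<xi>" and I: "finite I"
    and p: "p = (\<Sum>i\<in>I. c i *\<^sub>R f i)"
  shows "\<xi> p \<in> borel_measurable (observation_algebra M \<xi> I f)"
proof -
  note meas = gaussian_fieldD(3)[OF \<xi>]
  show ?thesis
  proof (rule observation_algebra_measurable_AE[OF meas])
    show "(\<lambda>\<omega>. \<Sum>i\<in>I. c i * \<xi> (f i) \<omega>) \<in> borel_measurable (observation_algebra M \<xi> I f)"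
      by (intro borel_measurable_sum borel_measurable_times borel_measurable_const observation_measurable meas)
    show "AE \<omega> in M. \<xi> p \<omega> = (\<Sum>i\<in>I. c i * \<xi> (f i) \<omega>)"
      unfolding p by (rule gaussian_field_sum[OF \<xi> I])
  qed (rule meas)
qed

text \<open>The residual \<open>\<xi> (\<theta> - p)\<close> integrates to zero over every observed
  event, while \<open>\<xi> p\<close> is itself observable; this characterizes the conditional
  expectation.\<close>

lemma gaussian_field_cond_exp:
  assumes "covariance_operator Q" and \<xi>: "gaussian_field M Q \<xi>" and I: "finite I"
    and p: "p = (\<Sum>i\<in>I. c i *\<^sub>R f i)"
    and orth: "\<And>i. i \<in> I \<Longrightarrow> blinfun_apply (f i) (Q (\<theta> - p)) = 0"
  shows "AE \<omega> in M. real_cond_exp M (observation_algebra M \<xi> I f) (\<xi> \<theta>) \<omega> = \<xi> p \<omega>"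
proof -
  note meas[measurable] = gaussian_fieldD(3)[OF \<xi>]
  let ?F = "observation_algebra M \<xi> I f"
  interpret F: finite_measure_subalgebra M ?F
    by unfold_locales (intro subalgebra_observation_algebra meas)
  show ?thesis
  proof (rule F.real_cond_exp_charact)
    show "integrable M (\<xi> \<theta>)" "integrable M (\<xi> p)"
      by (rule gaussian_fieldD(8)[OF \<xi>])+
    show "\<xi> p \<in> borel_measurable ?F"
      using \<xi> I p by (rule gaussian_field_combination_measurable)
    fix A assume A: "A \<in> sets ?F"
    then have [measurable]: "A \<in> events"
      using F.subalg by (auto simp: subalgebra_def)
    have int: "integrable M (\<lambda>\<omega>. indicator A \<omega> * \<xi> \<zeta> \<omega>)" for \<zeta>
      using integrable_mult_indicator[OF _ gaussian_fieldD(8)[OF \<xi>], of A \<zeta>] by simp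
    have "AE \<omega> in M. \<xi> (1 *\<^sub>R \<theta> + (-1) *\<^sub>R p) \<omega> = 1 * \<xi> \<theta> \<omega> + (-1) * \<xi> p \<omega>"
      by (rule gaussian_fieldD(5)[OF \<xi>])
    then have "AE \<omega> in M. \<xi> (\<theta> - p) \<omega> = \<xi> \<theta> \<omega> - \<xi> p \<omega>"
      by simp
    then have "AE \<omega> in M. indicator A \<omega> * \<xi> (\<theta> - p) \<omega> = indicator A \<omega> * \<xi> \<theta> \<omega> - indicator A \<omega> * \<xi> p \<omega>"
      by eventually_elim (simp only: right_diff_distrib)
    then have "(LINT \<omega>|M. indicator A \<omega> * \<xi> (\<theta> - p) \<omega>) =
        (LINT \<omega>|M. indicator A \<omega> * \<xi> \<theta> \<omega> - indicator A \<omega> * \<xi> p \<omega>)"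
      by (intro integral_cong_AE) auto
    then show "(LINT \<omega>:A|M. \<xi> \<theta> \<omega>) = (LINT \<omega>:A|M. \<xi> p \<omega>)"
      using integral_orthogonal_observation_eq_zero[OF \<xi> orth A] int
      by (simp add: set_lebesgue_integral_def)
  qed
qed

text \<open>Coarse observations are combinations of fine ones, and both algebras contain the same
  null events.\<close>

lemma observation_algebra_mono:
  assumes \<xi>: "gaussian_field M Q \<xi>" and J: "finite J"
    and f: "\<And>i. i \<in> I \<Longrightarrow> f i = (\<Sum>j\<in>J. c i j *\<^sub>R g j)"
  shows "sets (observation_algebra M \<xi> I f) \<subseteq> sets (observation_algebra M \<xi> J g)"
proof -
  note meas = gaussian_fieldD(3)[OF \<xi>]
  let ?F = "observation_algebra M \<xi> J g"
  have space: "space ?F = space M"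
    by (intro space_observation_algebra meas)
  have "\<xi> (f i) -` A \<inter> space M \<in> sets ?F" if "i \<in> I" "A \<in> sets borel" for i A
    using measurable_sets[OF gaussian_field_combination_measurable[OF \<xi> J f[OF that(1)]] that(2)]
    by (simp add: space)
  moreover have "null_sets M \<subseteq> sets ?F"
    by (intro null_sets_subset_observation_algebra meas)
  ultimately have "sigma_sets (space ?F) ({\<xi> (f i) -` A \<inter> space M |i A. i \<in> I \<and> A \<in> sets borel} \<union> null_sets M) \<subseteq> sets ?F"
    by (intro sets.sigma_sets_subset) auto
  then show ?thesis
    by (simp add: space sets_observation_algebra[of I \<xi> f, OF meas])
qed

section \<open>Gaussian fields obtained by a linear change of the index\<close>

lemma centered_gaussian_cong_AE:
  assumes "centered_gaussian M X" "Y \<in> borel_measurable M" "AE \<omega> in M. X \<omega> = Y \<omega>"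
  shows "centered_gaussian M Y"
proof -
  have X: "X \<in> borel_measurable M"
    using assms(1) by (simp add: centered_gaussian_def)
  have "distr M lborel X = distr M lborel Y"
    using assms X by (intro distr_cong_AE) auto
  moreover have "AE \<omega> in M. Y \<omega> = 0" if "AE \<omega> in M. X \<omega> = 0"
    using that assms(3) by eventually_elim simp
  ultimately show ?thesis
    using assms X by (auto simp: centered_gaussian_def distributed_def)
qed

text \<open>The hypothesis \<open>idem\<close> brings the covariance
  \<open>[R \<theta>, Q (R \<zeta>)]\<close> into the form \<open>[\<theta>, T \<zeta>]\<close> with
  \<open>T = Q \<circ> R\<close>; symmetry and nonnegativity of \<open>T\<close> come from the same
  identity.\<close>

lemma gaussian_field_transform:
  assumes "covariance_operator Q" and \<xi>: "gaussian_field M Q \<xi>" and R: "linear R"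
    and idem: "\<And>\<theta> \<zeta>. blinfun_apply (R \<theta>) (Q (R \<zeta>)) = blinfun_apply \<theta> (Q (R \<zeta>))"
    and \<eta>: "\<And>\<theta>. \<eta> \<theta> \<in> borel_measurable M" "\<And>\<theta>. AE \<omega> in M. \<eta> \<theta> \<omega> = \<xi> (R \<theta>) \<omega>"
  shows "gaussian_field M (Q \<circ> R) \<eta>"
proof -
  interpret covariance_operator Q by fact
  note [measurable] = gaussian_fieldD(3)[OF \<xi>] \<eta>(1)
  show ?thesis
    unfolding gaussian_field_def
  proof (intro conjI allI)
    show "linear (Q \<circ> R)"
      using R linear_Q by (rule linear_compose)
    have "blinfun_apply \<theta> (Q (R \<zeta>)) = blinfun_apply \<zeta> (Q (R \<theta>))" for \<theta> \<zeta>
      using idem form_commute[of "R \<theta>" "R \<zeta>"] by simp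
    then show "symmetric_op (Q \<circ> R)"
      by (simp add: symmetric_op_def)
    have nonneg: "blinfun_apply \<zeta> (Q \<zeta>) \<ge> 0" for \<zeta>
      using positive_Q by (cases "\<zeta> = 0") (auto simp: positive_op_def form_simps intro: less_imp_le)
    have "blinfun_apply \<theta> (Q (R \<theta>)) \<ge> 0" for \<theta>
      using nonneg[of "R \<theta>"] by (simp only: idem)
    then show "nonnegative_op (Q \<circ> R)"
      by (simp add: nonnegative_op_def)
    fix \<theta> \<zeta>
    show "\<eta> \<theta> \<in> borel_measurable M" by (rule \<eta>)
    have "integrable M (\<lambda>\<omega>. (\<xi> (R \<theta>) \<omega>)\<^sup>2) \<longleftrightarrow> integrable M (\<lambda>\<omega>. (\<eta> \<theta> \<omega>)\<^sup>2)"
      using \<eta>(2)[of \<theta>] by (intro integrable_cong_AE) (auto elim: eventually_mono)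
    then show "integrable M (\<lambda>\<omega>. (\<eta> \<theta> \<omega>)\<^sup>2)"
      using gaussian_fieldD(4)[OF \<xi>] by simp
    show "AE \<omega> in M. \<eta> (a *\<^sub>R \<theta> + b *\<^sub>R \<zeta>) \<omega> = a * \<eta> \<theta> \<omega> + b * \<eta> \<zeta> \<omega>" for a b
      using gaussian_fieldD(5)[OF \<xi>, of a "R \<theta>" b "R \<zeta>"] \<eta>(2)[of \<theta>] \<eta>(2)[of \<zeta>]
        \<eta>(2)[of "a *\<^sub>R \<theta> + b *\<^sub>R \<zeta>"]
      by eventually_elim (simp add: linear_add[OF R] linear_scale[OF R])
    have "(LINT \<omega>|M. \<eta> \<theta> \<omega> * \<eta> \<zeta> \<omega>) = (LINT \<omega>|M. \<xi> (R \<theta>) \<omega> * \<xi> (R \<zeta>) \<omega>)"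
    proof (rule integral_cong_AE)
      show "AE \<omega> in M. \<eta> \<theta> \<omega> * \<eta> \<zeta> \<omega> = \<xi> (R \<theta>) \<omega> * \<xi> (R \<zeta>) \<omega>"
        using \<eta>(2)[of \<theta>] \<eta>(2)[of \<zeta>] by eventually_elim simp
    qed measurable
    then show "(LINT \<omega>|M. \<eta> \<theta> \<omega> * \<eta> \<zeta> \<omega>) = blinfun_apply \<theta> ((Q \<circ> R) \<zeta>)"
      by (simp add: gaussian_fieldD(6)[OF \<xi>] idem)
    have "AE \<omega> in M. \<xi> (R \<theta>) \<omega> = \<eta> \<theta> \<omega>"
      using \<eta>(2)[of \<theta>] by eventually_elim simp
    then show "centered_gaussian M (\<eta> \<theta>)"
      by (rule centered_gaussian_cong_AE[OF gaussian_fieldD(7)[OF \<xi>] \<eta>(1)])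
  qed
qed

end

section \<open>The multiresolution martingale\<close>

lemma finite_tree_level:
  assumes "index_tree q I" "k \<in> levels q"
  shows "finite (tree_level I k)"
  using assms by (cases q) (auto simp: index_tree_def levels_def tree_level_def)

lemma tree_level_top:
  assumes "index_tree (enat m) I"
  shows "tree_level I m = I"
proof -
  have "restrict i {1..m} = i" if "i \<in> I" for i
    using assms that by (intro extensional_restrict) (auto simp: index_tree_def levels_def atLeastAtMost_def Int_def)
  then show ?thesis
    by (simp add: tree_level_def)
qed

text \<open>For finite \<open>q\<close> independence is assumed only at the top, so it descends
  level by level through the full-rank matrices; for \<open>q = \<infinity>\<close> there is no top
  and it is assumed at every level.\<close>

lemma nested_measurements_independent:
  assumes tree: "index_tree q I" and nested: "nested_measurements q I \<pi> \<phi>" and k: "k \<in> levels q"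
  shows "independent_family (tree_level I k) (\<phi> k)"
proof (cases q)
  case (enat m)
  have "1 \<le> k" "k \<le> m"
    using k by (auto simp: levels_def enat)
  from \<open>k \<le> m\<close> \<open>1 \<le> k\<close> show ?thesis
  proof (induction k rule: inc_induct)
    case base
    then show ?case
      using nested tree by (simp add: nested_measurements_def enat tree_level_top)
  next
    case (step n)
    then have n: "n \<in> levels q" "Suc n \<in> levels q"
      by (auto simp: levels_def enat)
    show ?case
    proof (rule nested_independent_family)
      show "independent_family (tree_level I (Suc n)) (\<phi> (Suc n))"
        using step by simp
      show "matrix_rank (tree_level I n) (tree_level I (Suc n)) (\<pi> n) = card (tree_level I n)"
        "\<And>i. i \<in> tree_level I n \<Longrightarrow> \<phi> n i = (\<Sum>j\<in>tree_level I (Suc n). \<pi> n i j *\<^sub>R \<phi> (Suc n) j)"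
        using nested n by (auto simp: nested_measurements_def)
    qed (use tree n in \<open>auto intro: finite_tree_level\<close>)
  qed
next
  case infinity
  then show ?thesis
    using nested k by (simp add: nested_measurements_def levels_def)
qed

lemma levels_downward: "k \<in> levels q" if "l \<in> levels q" "1 \<le> k" "k \<le> l"
  using that by (auto simp: levels_def intro: order_trans[of _ "enat l"])

text \<open>Placing \<open>X 1\<close> at index \<open>0\<close> of \<open>\<eta>\<close> lets a
  single family, indexed by the \<open>k\<close> with \<open>Suc k\<close> a level, express the
  joint independence of the first field and the increments.\<close>

theorem theorem5p8:
  fixes Q :: "'b::banach dual \<Rightarrow> 'b"
    and q :: enat
    and I :: "(nat \<Rightarrow> 'i) set"
    and \<pi> :: "nat \<Rightarrow> (nat \<Rightarrow> 'i) \<Rightarrow> (nat \<Rightarrow> 'i) \<Rightarrow> real"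
    and \<phi> :: "nat \<Rightarrow> (nat \<Rightarrow> 'i) \<Rightarrow> 'b dual"
    and M :: "'w measure"
    and \<xi> :: "('b, 'w) field"
  assumes "reflexive_space TYPE('b)"
    and "separable_space (euclidean :: 'b topology)"
    and "linear Q" and "bij Q" and "symmetric_op Q" and "positive_op Q"
    and "\<And>u. (norm u)\<^sup>2 = blinfun_apply (inv Q u) u"
    and "1 \<le> q"
    and "index_tree q I"
    and "nested_measurements q I \<pi> \<phi>"
    and "prob_space M"
    and "gaussian_field M Q \<xi>"
  defines "\<Sigma> \<equiv> \<lambda>k. observation_algebra M \<xi> (tree_level I k) (\<phi> k)"
  defines "X \<equiv> \<lambda>k. cond_exp_field M (\<Sigma> k) \<xi>"
  defines "\<psi> \<equiv> \<lambda>k. gamblet (tree_level I k) (\<phi> k)"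
  defines "\<eta> \<equiv> \<lambda>k. if k = 0 then X 1 else increment_field X k"
  shows "filtration_on M (levels q) \<Sigma> \<and>
    (\<forall>\<theta>. martingale_on M (levels q) \<Sigma> (\<lambda>k. X k \<theta>)) \<and>
    (\<forall>k. k \<in> levels q \<and> Suc k \<in> levels q \<longrightarrow>
       (\<forall>\<theta>. AE \<omega> in M. X k \<theta> \<omega> = cond_exp_field M (\<Sigma> k) (X (Suc k)) \<theta> \<omega>)) \<and>
    (\<forall>k. Suc k \<in> levels q \<longrightarrow> (\<exists>T. gaussian_field M T (\<eta> k))) \<and>
    independent_fields M {k. Suc k \<in> levels q} \<eta> \<and>
    (\<forall>k\<in>levels q. \<forall>\<theta>. AE \<omega> in M.
       X k \<theta> \<omega> = (\<Sum>i\<in>tree_level I k. blinfun_apply \<theta> (\<psi> k i) * \<xi> (\<phi> k i) \<omega>))"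
proof -
  interpret prob_space M by fact
  interpret covariance_operator Q
    by (rule covariance_operator.intro) fact+
  note \<xi> = \<open>gaussian_field M Q \<xi>\<close>
  note meas = gaussian_fieldD(3)[OF \<xi>]
  note fin = finite_tree_level[OF \<open>index_tree q I\<close>]
  note ind = nested_measurements_independent[OF \<open>index_tree q I\<close> \<open>nested_measurements q I \<pi> \<phi>\<close>]
  have nest: "\<phi> k i = (\<Sum>j\<in>tree_level I (Suc k). \<pi> k i j *\<^sub>R \<phi> (Suc k) j)"
    if "k \<in> levels q" "Suc k \<in> levels q" "i \<in> tree_level I k" for k i
    using \<open>nested_measurements q I \<pi> \<phi>\<close> that by (auto simp: nested_measurements_def)

  \<comment> \<open>With the empty level \<open>0\<close>, the field \<open>X 1\<close> is treated as the increment from level \<open>0\<close> to level \<open>1\<close>.\<close>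
  define S where "S k = (if k = 0 then {} else \<phi> k ` tree_level I k)" for k
  define P where "P k = orth_proj (S k)" for k
  define R where "R k \<theta> = P (Suc k) \<theta> - P k \<theta>" for k \<theta>
  have S_level: "S k = \<phi> k ` tree_level I k" if "k \<in> levels q" for k
    using that by (auto simp: S_def levels_def)
  have fin_S: "finite (S k)" if "k = 0 \<or> k \<in> levels q" for k
    using that fin[of k] by (auto simp: S_def)
  have S_Suc: "S k \<subseteq> span (S (Suc k))" if "Suc k \<in> levels q" for k
  proof (cases "k = 0")
    case False
    with that have k: "k \<in> levels q" using levels_downward[of "Suc k" q k] by simp
    have "\<phi> k i \<in> span (S (Suc k))" if "i \<in> tree_level I k" for i
      unfolding nest[OF k \<open>Suc k \<in> levels q\<close> that] S_level[OF \<open>Suc k \<in> levels q\<close>]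
      by (intro span_sum span_scale span_base imageI)
    then show ?thesis
      by (auto simp: S_level[OF k])
  qed (simp add: S_def)
  have span_mono_S: "span (S k) \<subseteq> span (S l)" if "k \<le> l" "l \<in> levels q" for k l
    using that
  proof (induction l rule: dec_induct)
    case (step n)
    \<comment> \<open>The case \<open>n = 0\<close> is separate because \<open>0\<close> is not a
      level; there \<open>k = 0\<close> and the span is trivial.\<close>
    show ?case
    proof (cases "n = 0")
      case True
      with step(1) show ?thesis by (simp add: S_def span_0)
    next
      case False
      then have "n \<in> levels q"
        using step.prems levels_downward[of "Suc n" q n] by simp
      then show ?thesis
        using step.IH span_mono[OF S_Suc[OF step.prems]] by (simp add: span_span)
    qed
  qed simp
  \<comment> \<open>The empty level projects to zero, so \<open>R 0\<close> is the projection to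
    level \<open>1\<close>, matching \<open>\<eta> 0\<close>.\<close>
  have P_0: "P 0 \<theta> = 0" for \<theta>
    using orth_proj_in_span[of "{}" \<theta>] by (simp add: P_def S_def)
  have P_gamblet: "P k \<theta> = (\<Sum>i\<in>tree_level I k. blinfun_apply \<theta> (\<psi> k i) *\<^sub>R \<phi> k i)"
    if "k \<in> levels q" for k \<theta>
    unfolding P_def \<psi>_def S_level[OF that]
    by (intro orth_proj_eq_gamblet_sum fin ind that \<open>bij Q\<close> assms(7))

  \<comment> \<open>The filtration of observation algebras\<close>
  have sub: "subalgebra M (\<Sigma> k)" for k
    unfolding \<Sigma>_def by (intro subalgebra_observation_algebra meas)
  have mono_Suc: "sets (\<Sigma> k) \<subseteq> sets (\<Sigma> (Suc k))" if "k \<in> levels q" "Suc k \<in> levels q" for k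
    unfolding \<Sigma>_def using that
    by (intro observation_algebra_mono[OF \<xi>, where c = "\<pi> k"] fin nest)
  have mono: "sets (\<Sigma> k) \<subseteq> sets (\<Sigma> l)" if "k \<in> levels q" "l \<in> levels q" "k \<le> l" for k l
    using \<open>k \<le> l\<close> \<open>l \<in> levels q\<close>
  proof (induction l rule: dec_induct)
    case (step n)
    then have "n \<in> levels q"
      using \<open>k \<in> levels q\<close> levels_downward[of "Suc n" q n] by (simp add: levels_def)
    with step show ?case
      using mono_Suc by blast
  qed simp
  have filtration: "filtration_on M (levels q) \<Sigma>"
    unfolding filtration_on_def using sub mono by blast

  \<comment> \<open>Conditional expectations and the martingale property\<close>
  have X_def': "X k \<theta> = real_cond_exp M (\<Sigma> k) (\<xi> \<theta>)" for k \<theta>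
    by (simp add: X_def cond_exp_field_def)
  have X_meas: "X k \<theta> \<in> borel_measurable (\<Sigma> k)" for k \<theta>
    by (simp add: X_def')
  have X_meas_M [measurable]: "X k \<theta> \<in> borel_measurable M" for k \<theta>
    using measurable_from_subalg[OF sub X_meas] .
  \<comment> \<open>The central identity: conditioning on level \<open>k\<close> acts on the index
    of the field as the projection \<open>P k\<close>.\<close>
  have X_P: "AE \<omega> in M. X k \<theta> \<omega> = \<xi> (P k \<theta>) \<omega>" if "k \<in> levels q" for k \<theta>
    unfolding X_def' \<Sigma>_def
  proof (rule gaussian_field_cond_exp[OF covariance_operator_axioms \<xi> fin[OF that] P_gamblet[OF that]])
    fix i assume "i \<in> tree_level I k"
    then show "blinfun_apply (\<phi> k i) (Q (\<theta> - P k \<theta>)) = 0"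
      unfolding P_def using that fin by (intro orth_proj_orth) (auto simp: S_level intro: span_base)
  qed
  have tower: "AE \<omega> in M. X k \<theta> \<omega> = real_cond_exp M (\<Sigma> k) (X l \<theta>) \<omega>"
    if "k \<in> levels q" "l \<in> levels q" "k \<le> l" for k l \<theta>
  proof -
    interpret F: finite_measure_subalgebra M "\<Sigma> k"
      by unfold_locales (rule sub)
    have "subalgebra (\<Sigma> l) (\<Sigma> k)"
      using sub[of k] sub[of l] mono[OF that] by (simp add: subalgebra_def)
    then have "AE \<omega> in M. real_cond_exp M (\<Sigma> k) (X l \<theta>) \<omega> = X k \<theta> \<omega>"
      unfolding X_def' by (intro F.real_cond_exp_nested_subalg sub gaussian_fieldD(8)[OF \<xi>])
    then show ?thesis
      by eventually_elim simp
  qed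
  have X_int: "integrable M (X k \<theta>)" for k \<theta>
  proof -
    interpret F: finite_measure_subalgebra M "\<Sigma> k"
      by unfold_locales (rule sub)
    show ?thesis
      unfolding X_def' by (intro F.real_cond_exp_int gaussian_fieldD(8)[OF \<xi>])
  qed
  have martingale: "martingale_on M (levels q) \<Sigma> (\<lambda>k. X k \<theta>)" for \<theta>
    unfolding martingale_on_def using X_meas X_int tower by blast

  \<comment> \<open>The increments as Gaussian fields\<close>
  have \<eta>_meas [measurable]: "\<eta> k \<theta> \<in> borel_measurable M" for k \<theta>
    by (simp add: \<eta>_def increment_field_def)
  have \<eta>_R: "AE \<omega> in M. \<eta> k \<theta> \<omega> = \<xi> (R k \<theta>) \<omega>" if "Suc k \<in> levels q" for k \<theta>
  proof (cases "k = 0")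
    case True
    then show ?thesis
      using X_P[OF that, of \<theta>] by (simp add: \<eta>_def R_def P_0)
  next
    case False
    with that have k: "k \<in> levels q" using levels_downward[of "Suc k" q k] by simp
    have "AE \<omega> in M. \<xi> (1 *\<^sub>R P (Suc k) \<theta> + (-1) *\<^sub>R P k \<theta>) \<omega> = 1 * \<xi> (P (Suc k) \<theta>) \<omega> + (-1) * \<xi> (P k \<theta>) \<omega>"
      by (rule gaussian_fieldD(5)[OF \<xi>])
    with X_P[OF that, of \<theta>] X_P[OF k, of \<theta>] show ?thesis
      by eventually_elim (simp add: \<eta>_def increment_field_def R_def False)
  qed
  have fin_pair: "finite (S k)" "finite (S (Suc k))" if "Suc k \<in> levels q" for k
    using that levels_downward[of "Suc k" q k] by (cases k; auto intro!: fin_S)+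
  have lin_R: "linear (R k)" if "Suc k \<in> levels q" for k
    unfolding R_def[abs_def] P_def using fin_pair[OF that] by (intro linear_compose_sub linear_orth_proj)
  \<comment> \<open>The difference of nested projections \<open>R k\<close> satisfies the identity
    required by the transformation lemma, which gives the increment the covariance operator
    \<open>Q \<circ> R k\<close>.\<close>
  have gaussian: "gaussian_field M (Q \<circ> R k) (\<eta> k)" if "Suc k \<in> levels q" for k
  proof (rule gaussian_field_transform[OF covariance_operator_axioms \<xi> lin_R[OF that] _ \<eta>_meas \<eta>_R[OF that]])
    show "blinfun_apply (R k \<theta>) (Q (R k \<zeta>)) = blinfun_apply \<theta> (Q (R k \<zeta>))" for \<theta> \<zeta>
      unfolding R_def P_def using fin_pair[OF that] S_Suc[OF that] by (rule orth_proj_diff_idem)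
  qed

  \<comment> \<open>Orthogonality and independence of the increments\<close>
  have R_orth_less: "blinfun_apply (R k \<theta>) (Q (R l \<zeta>)) = 0"
    if "Suc l \<in> levels q" "k < l" for k l \<theta> \<zeta>
  proof -
    have l: "l \<in> levels q"
      using that levels_downward[of "Suc l" q l] by simp
    have k: "Suc k \<in> levels q"
      using that l levels_downward[of l q "Suc k"] by simp
    \<comment> \<open>The increment of index \<open>k\<close> lives in the span of level
      \<open>Suc k\<close>, which is contained in that of level \<open>l\<close> because
      \<open>k < l\<close>; \<open>R l\<close> is orthogonal to the latter.\<close>
    have "R k \<theta> \<in> span (S (Suc k))"
      unfolding R_def P_def
      using orth_proj_in_span[OF fin_pair(1)[OF k]] orth_proj_in_span[OF fin_pair(2)[OF k]]
        span_mono_S[of k "Suc k"] k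
      by (intro span_diff) auto
    then have "R k \<theta> \<in> span (S l)"
      using span_mono_S[of "Suc k" l] that l by auto
    then show ?thesis
      unfolding R_def[of l] P_def using fin_pair[OF that(1)] S_Suc[OF that(1)]
      by (intro orth_proj_diff_orth)
  qed
  have R_orth: "blinfun_apply (R k \<theta>) (Q (R l \<zeta>)) = 0"
    if "Suc k \<in> levels q" "Suc l \<in> levels q" "k \<noteq> l" for k l \<theta> \<zeta>
  proof (cases "k < l")
    case True
    with that show ?thesis by (intro R_orth_less)
  next
    case False
    with that have "blinfun_apply (R l \<zeta>) (Q (R k \<theta>)) = 0"
      by (intro R_orth_less) auto
    then show ?thesis
      by (subst form_commute)
  qed
  \<comment> \<open>Each block has all functionals as its coordinates, so this is independence of
    whole fields.\<close>
  have "indep_vars (\<lambda>k. PiM (UNIV :: 'b dual set) (\<lambda>_. borel)) (\<lambda>k \<omega>. \<lambda>\<theta>\<in>UNIV. \<eta> k \<theta> \<omega>) {k. Suc k \<in> levels q}"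
    by (rule gaussian_field_orthogonal_imp_indep[OF \<xi>, where f = R])
      (use \<eta>_R R_orth in auto)
  then have independent: "independent_fields M {k. Suc k \<in> levels q} \<eta>"
    by (simp add: independent_fields_def restrict_UNIV)

  \<comment> \<open>The gamblet expansion\<close>
  have expansion: "AE \<omega> in M. X k \<theta> \<omega> = (\<Sum>i\<in>tree_level I k. blinfun_apply \<theta> (\<psi> k i) * \<xi> (\<phi> k i) \<omega>)"
    if "k \<in> levels q" for k \<theta>
    using X_P[OF that, of \<theta>] gaussian_field_sum[OF \<xi> fin[OF that], of "\<lambda>i. blinfun_apply \<theta> (\<psi> k i)" "\<phi> k"]
    by eventually_elim (simp add: P_gamblet[OF that])
  have "\<exists>T. gaussian_field M T (\<eta> k)" if "Suc k \<in> levels q" for k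
    using gaussian[OF that] by blast
  then show ?thesis
    using filtration martingale tower independent expansion
    by (auto simp: cond_exp_field_def)
qed

end
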